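(* There exists a polynomial-space randomized algorithm for $\mathrm{MAX}\text{-}k\text{-}\mathrm{SAT}$ running in $$O^\ast\left(\left(2-\Omega\left(\frac{\varepsilon}{k}\log\left(\frac{k}{\varepsilon}\right)\right)\right)^n\right)$$ time that finds with high probability an assignment $z\in\{0,1\}^n$ such that $\mathcal{C}(f,z)\ge (1-\varepsilon)m^\ast$. Here $\varepsilon\in(0,1]$.
   Context: Here $f$ is the input instance of (unweighted) $\mathrm{MAX}\text{-}k\text{-}\mathrm{SAT}$, that is, an instance of $k\text{-}\mathrm{SAT}$ with $n$ Boolean variables and $m$ clauses, each clause being a disjunction of literals (variables or negated variables) of length in $\{1,\dots,k\}$; the goal is to satisfy as many clauses as possible. For an assignment $z\in\{0,1\}^n$, $\mathcal{C}(f,z)$ denotes the number of clauses of $f$ satisfied by $z$, and $m^\ast=\max_{z\in\{0,1\}^n}\mathcal{C}(f,z)$. The notation $O^\ast(\cdot)$ removes $\mathrm{poly}(n)$ factors, and $\Omega(\cdot)$ is the usual asymptotic lower-bound notation. *)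

theory Defs
  imports
    "HOL-Probability.Probability"
    "HOL-Computational_Algebra.Polynomial"
    "HOL-Library.Log_Nat"
begin

section \<open>MAX-k-SAT\<close>

datatype literal = Pos nat | Neg nat

type_synonym clause = "literal list"
type_synonym formula = "clause list"

fun var :: "literal \<Rightarrow> nat" where
  "var (Pos i) = i"
| "var (Neg i) = i"

(* Variables are numbered 0..n-1.  A formula is a list of clauses, so a clause may occur
   repeatedly; the number m of clauses is the length of the list. *)
definition ksat_instance :: "nat \<Rightarrow> nat \<Rightarrow> formula \<Rightarrow> bool" where
  "ksat_instance k n f \<longleftrightarrow>
     (\<forall>C\<in>set f. 1 \<le> length C \<and> length C \<le> k \<and> (\<forall>l\<in>set C. var l < n))"

fun sat_literal :: "bool list \<Rightarrow> literal \<Rightarrow> bool" where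
  "sat_literal z (Pos i) = z ! i"
| "sat_literal z (Neg i) = (\<not> z ! i)"

definition sat_clause :: "bool list \<Rightarrow> clause \<Rightarrow> bool" where
  "sat_clause z C \<longleftrightarrow> (\<exists>l\<in>set C. sat_literal z l)"

definition num_sat :: "formula \<Rightarrow> bool list \<Rightarrow> nat" where
  "num_sat f z = length (filter (sat_clause z) f)"

definition max_sat :: "nat \<Rightarrow> formula \<Rightarrow> nat" where
  "max_sat n f = Max (num_sat f ` {z. length z = n})"

section \<open>Randomized random access machines\<close>

text \<open>
  Algorithms are programs of a random access machine with indirect addressing and fair coin
  tosses, under the logarithmic cost criterion: an instruction costs one plus the binary lengths
  of the numbers and addresses it handles.  Programs are finite and
  structured.  Registers are named directly by the program, so a program uses only finitely many
  of them; memory cells are reached only through addresses held in registers.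
\<close>

datatype arith = Add | Sub | Mult | Div

fun arith_val :: "arith \<Rightarrow> nat \<Rightarrow> nat \<Rightarrow> nat" where
  "arith_val Add x y = x + y"
| "arith_val Sub x y = x - y"
| "arith_val Mult x y = x * y"
| "arith_val Div x y = x div y"

datatype instr =
    Const nat nat
  | Arith arith nat nat nat
  | Load nat nat
  | Store nat nat
  | Toss nat
  | IfNZ nat "instr list" "instr list"
  | WhileNZ nat "instr list"

type_synonym program = "instr list"

(* The remaining code plays the part of a program counter: for a fixed program only finitely many
   values of it are reachable, so it does not count as space.  The field cost accumulates
   the running time. *)
record config =
  code :: program
  reg :: "nat \<Rightarrow> nat"
  mem :: "nat \<Rightarrow> nat"
  cost :: nat

abbreviation len :: "nat \<Rightarrow> nat" where
  "len x \<equiv> floorlog 2 x"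

(* A halted configuration (empty code) is left unchanged. *)
definition step :: "config \<Rightarrow> config pmf" where
  "step c = (case code c of
     [] \<Rightarrow> return_pmf c
   | i # K \<Rightarrow> (case i of
       Const r v \<Rightarrow> return_pmf
         (c\<lparr>code := K, reg := (reg c)(r := v), cost := cost c + 1 + len v\<rparr>)
     | Arith p r a b \<Rightarrow> return_pmf
         (c\<lparr>code := K, reg := (reg c)(r := arith_val p (reg c a) (reg c b)),
            cost := cost c + 1 + len (reg c a) + len (reg c b)\<rparr>)
     | Load r a \<Rightarrow> return_pmf
         (c\<lparr>code := K, reg := (reg c)(r := mem c (reg c a)),
            cost := cost c + 1 + len (reg c a) + len (mem c (reg c a))\<rparr>)
     | Store a r \<Rightarrow> return_pmf
         (c\<lparr>code := K, mem := (mem c)(reg c a := reg c r),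
            cost := cost c + 1 + len (reg c a) + len (reg c r)\<rparr>)
     | Toss r \<Rightarrow> map_pmf (\<lambda>b.
          c\<lparr>code := K, reg := (reg c)(r := of_bool b), cost := cost c + 1\<rparr>)
         (bernoulli_pmf (1/2))
     | IfNZ r P Q \<Rightarrow> return_pmf
         (c\<lparr>code := (if reg c r \<noteq> 0 then P else Q) @ K, cost := cost c + 1 + len (reg c r)\<rparr>)
     | WhileNZ r P \<Rightarrow> return_pmf
         (c\<lparr>code := (if reg c r \<noteq> 0 then P @ WhileNZ r P # K else K),
            cost := cost c + 1 + len (reg c r)\<rparr>)))"

primrec run :: "nat \<Rightarrow> config \<Rightarrow> config pmf" where
  "run 0 c = return_pmf c"
| "run (Suc j) c = bind_pmf (step c) (run j)"

(* The input words occupy memory cells 0, 1, ...; all other cells and all registers are 0. *)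
definition init :: "program \<Rightarrow> nat list \<Rightarrow> config" where
  "init M xs = \<lparr>code = M, reg = (\<lambda>_. 0),
     mem = (\<lambda>a. if a < length xs then xs ! a else 0), cost = 0\<rparr>"

(* Only finitely many registers and cells are nonzero in a reachable configuration.  A nonzero
   cell is charged for its address and its contents; the input is included. *)
definition space :: "config \<Rightarrow> nat" where
  "space c = (\<Sum>r | reg c r \<noteq> 0. len (reg c r)) + (\<Sum>a | mem c a \<noteq> 0. len a + len (mem c a))"

(* Worst case over all coin tosses: the run halts at cost at most T and never holds
   more than S bits. *)
definition runs_within :: "program \<Rightarrow> nat list \<Rightarrow> real \<Rightarrow> real \<Rightarrow> bool" where
  "runs_within M xs T S \<longleftrightarrow>
     (\<exists>j. \<forall>c\<in>set_pmf (run j (init M xs)). code c = [] \<and> real (cost c) \<le> T) \<and>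
     (\<forall>j. \<forall>c\<in>set_pmf (run j (init M xs)). real (space c) \<le> S)"

(* Probability of halting with memory contents satisfying Q.  Halted configurations are
   absorbing, so the probabilities increase with j and the supremum is their limit. *)
definition success_prob :: "program \<Rightarrow> nat list \<Rightarrow> ((nat \<Rightarrow> nat) \<Rightarrow> bool) \<Rightarrow> real" where
  "success_prob M xs Q =
     (SUP j. measure_pmf.prob (run j (init M xs)) {c. code c = [] \<and> Q (mem c)})"

section \<open>Input and output\<close>

fun enc_literal :: "literal \<Rightarrow> nat" where
  "enc_literal (Pos i) = 2 * i"
| "enc_literal (Neg i) = 2 * i + 1"

definition enc_instance :: "nat \<Rightarrow> formula \<Rightarrow> nat list" where
  "enc_instance n f =
     n # length f # concat (map (\<lambda>C. length C # map enc_literal C) f)"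

(* The output is read off the first n memory cells. *)
definition out_assignment :: "nat \<Rightarrow> (nat \<Rightarrow> nat) \<Rightarrow> bool list" where
  "out_assignment n \<mu> = map (\<lambda>i. \<mu> i \<noteq> 0) [0..<n]"

end

theory Submission
  imports Defs
begin

text \<open>
  Sample uniformly random assignments and keep the best one.  Let \<open>z\<close> be optimal and
  \<open>\<delta> = \<epsilon> / 2\<close>.  Flipping a random set of \<open>d = \<lfloor>\<delta> n\<rfloor>\<close> variables of \<open>z\<close> destroys a clause satisfied
  by \<open>z\<close> with probability at most \<open>\<delta>\<close>, so by Markov's inequality at least half of the flips are good.
  Hence there are at least \<open>(n choose d) / 2 \<ge> (\<delta> / 2) exp (x n)\<close> good assignments, where
  \<open>x = \<delta> ln (1 / \<delta>)\<close>, and \<open>O((n + 1) \<rho>^n)\<close> samples suffice for every \<open>\<rho> \<ge> 2 exp (- x)\<close>.  The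
  machine computes this number with a rational \<open>\<rho> = P / Q\<close> strictly between \<open>2 - x\<close> and the base
  of the claimed running time.  Note that \<open>(\<epsilon> / k) ln (k / \<epsilon>) \<le> 2 x\<close> although \<open>x\<close> does not depend
  on \<open>k\<close>.
\<close>

section \<open>Reasoning about randomized programs\<close>

text \<open>Time and space are worst case over the tosses, whereas success is a limit of
  probabilities of runs. Both are reduced to deterministic runs on a fixed coin tape: the number of
  samples is computed before the first toss, so for a given input every run reads equally many
  coins, and what remains of probability is to count good tapes. Losses are compared with the
  clauses that \<open>z\<close> satisfies, and each of these is guarded by a single true literal;
  hence neither the clause length nor the number of clauses enters the count of good assignments.
  The machine has only integers, so \<rho> is rational and its power is a quotient of two exact
  powers. The linear base 2 - x is admissible since (2 - x) (1 + x) \<ge> 2 on [0, 1] and 1 + x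
  \<le> exp x. The factor n + 1, together with a constant C chosen from the degree a, makes the
  failure probability at most (n + 1)^(-a).\<close>

definition tosses :: "config \<Rightarrow> bool" where
  "tosses c \<longleftrightarrow> (\<exists>r K. code c = Toss r # K)"

text \<open>Outside tosses \<open>step\<close> yields a point distribution and
  \<open>return_pmf\<close> is injective, so the choice operator recovers the unique successor and
  the instruction semantics need not be repeated.\<close>

definition coin_step :: "config \<Rightarrow> bool \<Rightarrow> config" where
  "coin_step c b = (if tosses c
     then c\<lparr>code := tl (code c),
            reg := (reg c)(case hd (code c) of Toss r \<Rightarrow> r | _ \<Rightarrow> 0 := of_bool b), cost := cost c + 1\<rparr>
     else (SOME c'. step c = return_pmf c'))"

lemma coin_step_simps:
  "code c = [] \<Longrightarrow> coin_step c x = c"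
  "code c = Const r v # K \<Longrightarrow>
     coin_step c x = c\<lparr>code := K, reg := (reg c)(r := v), cost := cost c + 1 + len v\<rparr>"
  "code c = Arith p r a b # K \<Longrightarrow>
     coin_step c x = c\<lparr>code := K, reg := (reg c)(r := arith_val p (reg c a) (reg c b)),
            cost := cost c + 1 + len (reg c a) + len (reg c b)\<rparr>"
  "code c = Load r a # K \<Longrightarrow>
     coin_step c x = c\<lparr>code := K, reg := (reg c)(r := mem c (reg c a)),
            cost := cost c + 1 + len (reg c a) + len (mem c (reg c a))\<rparr>"
  "code c = Store a r # K \<Longrightarrow>
     coin_step c x = c\<lparr>code := K, mem := (mem c)(reg c a := reg c r),
            cost := cost c + 1 + len (reg c a) + len (reg c r)\<rparr>"
  "code c = Toss r # K \<Longrightarrow>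
     coin_step c x = c\<lparr>code := K, reg := (reg c)(r := of_bool x), cost := cost c + 1\<rparr>"
  "code c = IfNZ r P Q # K \<Longrightarrow>
     coin_step c x = c\<lparr>code := (if reg c r \<noteq> 0 then P else Q) @ K, cost := cost c + 1 + len (reg c r)\<rparr>"
  "code c = WhileNZ r P # K \<Longrightarrow>
     coin_step c x = c\<lparr>code := (if reg c r \<noteq> 0 then P @ WhileNZ r P # K else K),
            cost := cost c + 1 + len (reg c r)\<rparr>"
  by (simp_all add: coin_step_def tosses_def step_def)

lemma step_eq_coin_step:
  "step c = (if tosses c then map_pmf (coin_step c) (bernoulli_pmf (1/2))
             else return_pmf (coin_step c False))"
proof (cases "code c")
  case Nil
  then show ?thesis by (simp add: coin_step_simps tosses_def step_def)
next
  case (Cons i K)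
  then show ?thesis
  proof (cases i)
    case (Toss r)
    with Cons have "coin_step c = (\<lambda>b. c\<lparr>code := K, reg := (reg c)(r := of_bool b), cost := cost c + 1\<rparr>)"
      by (simp add: fun_eq_iff coin_step_simps)
    with Cons Toss show ?thesis by (simp add: tosses_def step_def)
  qed (simp_all add: coin_step_simps tosses_def step_def)
qed

text \<open>Coins are consumed on demand; an exhausted tape yields junk.\<close>
fun tape_run :: "nat \<Rightarrow> config \<Rightarrow> bool list \<Rightarrow> config" where
  "tape_run 0 c bs = c"
| "tape_run (Suc j) c bs =
     (if tosses c then tape_run j (coin_step c (hd bs)) (tl bs)
      else tape_run j (coin_step c False) bs)"

abbreviation coins :: "nat \<Rightarrow> bool list pmf" where
  "coins L \<equiv> replicate_pmf L (bernoulli_pmf (1/2))"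

text \<open>A run of j steps reads at most j coins. All randomness can therefore be drawn in advance
  on any tape of length at least j, the unread coins being integrated out.\<close>

lemma run_eq_tape_run: "j \<le> L \<Longrightarrow> run j c = map_pmf (tape_run j c) (coins L)"
proof (induction j arbitrary: c L)
  case 0
  then show ?case by simp
next
  case (Suc j)
  then obtain L' where L: "L = Suc L'" "j \<le> L'" by (cases L) auto
  show ?case
  proof (cases "tosses c")
    case True
    have "run (Suc j) c = bind_pmf (bernoulli_pmf (1/2)) (\<lambda>b. run j (coin_step c b))"
      using True by (simp add: step_eq_coin_step bind_map_pmf)
    also have "\<dots> = bind_pmf (bernoulli_pmf (1/2)) (\<lambda>b. map_pmf (tape_run j (coin_step c b)) (coins L'))"
      using Suc.IH L by simp
    also have "\<dots> = map_pmf (tape_run (Suc j) c) (coins L)"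
      using True by (simp add: L map_bind_pmf map_pmf_def bind_assoc_pmf bind_return_pmf)
    finally show ?thesis .
  next
    case False
    then show ?thesis
      using Suc.IH[of L "coin_step c False"] Suc.prems 
      by (simp add: step_eq_coin_step bind_return_pmf)
  qed
qed

lemma tape_run_halted: "code c = [] \<Longrightarrow> tape_run j c bs = c"
  by (induction j) (simp_all add: tosses_def coin_step_simps)

text \<open>
  A Hoare logic with explicit coin tape: \<open>computes Q P g \<mu> bs t\<close> says that \<open>P\<close>, started from
  registers \<open>g\<close> and memory \<open>\<mu>\<close>, consumes exactly the tosses \<open>bs\<close>, halts after at most \<open>t\<close> steps
  in a state satisfying \<open>Q\<close>, and on the way uses only registers below \<open>R\<close>, memory cells below \<open>A\<close>
  and values below \<open>V\<close>.  The values computed by \<open>Sub\<close>, \<open>Div\<close>, \<open>Load\<close> and \<open>Store\<close> are bounded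
  by values already present, so they need no side condition.
\<close>
locale bounded_ram = fixes R V A :: nat
begin

inductive computes ::
    "((nat \<Rightarrow> nat) \<Rightarrow> (nat \<Rightarrow> nat) \<Rightarrow> bool) \<Rightarrow> program \<Rightarrow> (nat \<Rightarrow> nat) \<Rightarrow> (nat \<Rightarrow> nat)
      \<Rightarrow> bool list \<Rightarrow> nat \<Rightarrow> bool" for Q where
  Nil: "Q g \<mu> \<Longrightarrow> computes Q [] g \<mu> [] t"
| Const: "r < R \<Longrightarrow> v < V \<Longrightarrow> computes Q K (g(r := v)) \<mu> bs t
    \<Longrightarrow> computes Q (Const r v # K) g \<mu> bs (Suc t)"
| Arith: "r < R \<Longrightarrow> p = Add \<or> p = Mult \<longrightarrow> arith_val p (g a) (g b) < V
    \<Longrightarrow> computes Q K (g(r := arith_val p (g a) (g b))) \<mu> bs t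
    \<Longrightarrow> computes Q (Arith p r a b # K) g \<mu> bs (Suc t)"
| Load: "r < R \<Longrightarrow> computes Q K (g(r := \<mu> (g a))) \<mu> bs t
    \<Longrightarrow> computes Q (Load r a # K) g \<mu> bs (Suc t)"
| Store: "g a < A \<Longrightarrow> computes Q K g (\<mu>(g a := g r)) bs t
    \<Longrightarrow> computes Q (Store a r # K) g \<mu> bs (Suc t)"
| Toss: "r < R \<Longrightarrow> computes Q K (g(r := of_bool b)) \<mu> bs t
    \<Longrightarrow> computes Q (Toss r # K) g \<mu> (b # bs) (Suc t)"
| IfNZ: "computes Q ((if g r \<noteq> 0 then P1 else P2) @ K) g \<mu> bs t
    \<Longrightarrow> computes Q (IfNZ r P1 P2 # K) g \<mu> bs (Suc t)"
| WhileNZ: "computes Q (if g r \<noteq> 0 then P @ WhileNZ r P # K else K) g \<mu> bs t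
    \<Longrightarrow> computes Q (WhileNZ r P # K) g \<mu> bs (Suc t)"

definition fits :: "(nat \<Rightarrow> nat) \<Rightarrow> (nat \<Rightarrow> nat) \<Rightarrow> bool" where
  "fits g \<mu> \<longleftrightarrow> (\<forall>r. g r < V) \<and> (\<forall>r\<ge>R. g r = 0) \<and> (\<forall>a. \<mu> a < V) \<and> (\<forall>a\<ge>A. \<mu> a = 0)"

lemma computes_mono:
  assumes "computes Q P g \<mu> bs t" "t \<le> t'"
  shows "computes Q P g \<mu> bs t'"
proof -
  from assms(1) have "computes Q P g \<mu> bs (t + d)" for d
    by induction ((simp only: add_Suc)?, rule computes.intros; assumption)+
  from this[of "t' - t"] show ?thesis using assms(2) by simp
qed

lemma computes_weaken:
  assumes "computes Q P g \<mu> bs t" "\<And>g \<mu>. Q g \<mu> \<Longrightarrow> Q' g \<mu>"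
  shows "computes Q' P g \<mu> bs t"
  using assms(1)
  by induction (rule computes.intros; (assumption | (rule assms(2), assumption)))+

text \<open>As equivalences, these rules let the simplifier execute straight-line code symbolically.
  The rule for loops stays outside the simp set, where it would unroll forever, and is applied once
  per induction step.\<close>

lemma computes_straight [simp]:
  "computes Q [] g \<mu> bs t \<longleftrightarrow> bs = [] \<and> Q g \<mu>"
  "computes Q (Const r v # K) g \<mu> bs t \<longleftrightarrow>
     0 < t \<and> r < R \<and> v < V \<and> computes Q K (g(r := v)) \<mu> bs (t - 1)"
  "computes Q (Arith p r a b # K) g \<mu> bs t \<longleftrightarrow>
     0 < t \<and> r < R \<and> (p = Add \<or> p = Mult \<longrightarrow> arith_val p (g a) (g b) < V)
     \<and> computes Q K (g(r := arith_val p (g a) (g b))) \<mu> bs (t - 1)"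
  "computes Q (Load r a # K) g \<mu> bs t \<longleftrightarrow>
     0 < t \<and> r < R \<and> computes Q K (g(r := \<mu> (g a))) \<mu> bs (t - 1)"
  "computes Q (Store a r # K) g \<mu> bs t \<longleftrightarrow>
     0 < t \<and> g a < A \<and> computes Q K g (\<mu>(g a := g r)) bs (t - 1)"
  "computes Q (IfNZ r P1 P2 # K) g \<mu> bs t \<longleftrightarrow>
     0 < t \<and> computes Q ((if g r \<noteq> 0 then P1 else P2) @ K) g \<mu> bs (t - 1)"
  by (subst computes.simps; cases t; auto)+

lemma computes_Toss [simp]:
  "computes Q (Toss r # K) g \<mu> (b # bs) t \<longleftrightarrow>
     0 < t \<and> r < R \<and> computes Q K (g(r := of_bool b)) \<mu> bs (t - 1)"
  by (subst computes.simps; cases t; auto)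

lemma computes_WhileNZ:
  "computes Q (WhileNZ r P # K) g \<mu> bs t \<longleftrightarrow>
     0 < t \<and> computes Q (if g r \<noteq> 0 then P @ WhileNZ r P # K else K) g \<mu> bs (t - 1)"
  by (subst computes.simps; cases t; auto)

section \<open>Soundness of the program logic with respect to runs\<close>

definition halts_in :: "nat \<Rightarrow> ((nat \<Rightarrow> nat) \<Rightarrow> (nat \<Rightarrow> nat) \<Rightarrow> bool) \<Rightarrow> config \<Rightarrow> bool list \<Rightarrow> nat \<Rightarrow> bool" where
  "halts_in W Q c bs t \<longleftrightarrow> (\<forall>j. fits (reg (tape_run j c bs)) (mem (tape_run j c bs)) \<and>
     (t \<le> j \<longrightarrow> code (tape_run j c bs) = [] \<and> cost (tape_run j c bs) \<le> cost c + t * (1 + 2 * W) \<and>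
       Q (reg (tape_run j c bs)) (mem (tape_run j c bs))))"

lemma halts_in_Suc:
  assumes "fits (reg c) (mem c)" "cost (coin_step c b) \<le> cost c + (1 + 2 * W)"
    and "if tosses c then bs = b # bs' else bs' = bs \<and> \<not> b"
    and "halts_in W Q (coin_step c b) bs' t"
  shows "halts_in W Q c bs (Suc t)"
  unfolding halts_in_def
proof
  fix j
  show "fits (reg (tape_run j c bs)) (mem (tape_run j c bs)) \<and>
     (Suc t \<le> j \<longrightarrow> code (tape_run j c bs) = [] \<and> cost (tape_run j c bs) \<le> cost c + Suc t * (1 + 2 * W) \<and>
       Q (reg (tape_run j c bs)) (mem (tape_run j c bs)))"
  proof (cases j)
    case 0
    then show ?thesis using assms(1) by simp
  next
    case (Suc i)
    have "tape_run j c bs = tape_run i (coin_step c b) bs'"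
      using assms(3) Suc by (auto split: if_splits)
    then show ?thesis
      using assms(4)[unfolded halts_in_def, THEN spec[of _ i]] assms(2) Suc
      by (auto simp: algebra_simps)
  qed
qed

text \<open>An instruction handles at most two numbers, each of at most W binary digits, and so
  costs at most \<open>1 + 2 * W\<close>. The suffix \<open>bs'\<close> is arbitrary because the
  program never reads it. The invariant \<open>fits\<close> is tracked at every time, not only at
  the end, since space is measured along the whole run.\<close>

lemma computes_sound:
  assumes "computes Q P g \<mu> bs t" "code c = P" "reg c = g" "mem c = \<mu>" "fits g \<mu>"
    and V: "V = 2 ^ W" "A \<le> V" and "2 \<le> V"
  shows "halts_in W Q c (bs @ bs') t"
proof -
  have W: "len x \<le> W" if "x < V" for x
    using that V by (auto intro: floorlog_leI)
  show ?thesis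
    using assms(1-5)
  proof (induction arbitrary: c rule: computes.induct)
    case (Nil g \<mu> t)
    then show ?case by (auto simp: tape_run_halted halts_in_def)
  next
    case (Const r v K g \<mu> bs t)
    have fits: "fits (g(r := v)) \<mu>" using Const.prems Const.hyps by (auto simp: fits_def)
    show ?case
    proof (rule halts_in_Suc[of _ False])
      show "cost (coin_step c False) \<le> cost c + (1 + 2 * W)"
        using W[of v] Const.hyps Const.prems by (simp add: coin_step_simps)
      show "halts_in W Q (coin_step c False) (bs @ bs') t"
        by (rule Const.IH[OF _ _ _ fits]) (use Const.prems in \<open>simp_all add: coin_step_simps\<close>)
    qed (use Const.prems in \<open>simp_all add: tosses_def\<close>)
  next
    case (Arith r p g a b K \<mu> bs t)
    have g: "g x < V" for x using Arith.prems by (auto simp: fits_def)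
    have "arith_val p (g a) (g b) < V"
      using Arith.hyps(2) g[of a] order.strict_trans1[OF div_le_dividend g[of a]]
      by (cases p) (auto simp: less_imp_diff_less)
    hence fits: "fits (g(r := arith_val p (g a) (g b))) \<mu>"
      using Arith.prems Arith.hyps(1) by (auto simp: fits_def)
    show ?case
    proof (rule halts_in_Suc[of _ False])
      show "cost (coin_step c False) \<le> cost c + (1 + 2 * W)"
        using W[OF g[of a]] W[OF g[of b]] Arith.prems by (simp add: coin_step_simps)
      show "halts_in W Q (coin_step c False) (bs @ bs') t"
        by (rule Arith.IH[OF _ _ _ fits]) (use Arith.prems in \<open>simp_all add: coin_step_simps\<close>)
    qed (use Arith.prems in \<open>simp_all add: tosses_def\<close>)
  next
    case (Load r K g \<mu> a bs t)
    have g: "g a < V" "\<mu> (g a) < V" using Load.prems by (auto simp: fits_def)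
    hence fits: "fits (g(r := \<mu> (g a))) \<mu>" using Load.prems Load.hyps(1) by (auto simp: fits_def)
    show ?case
    proof (rule halts_in_Suc[of _ False])
      show "cost (coin_step c False) \<le> cost c + (1 + 2 * W)"
        using W[OF g(1)] W[OF g(2)] Load.prems by (simp add: coin_step_simps)
      show "halts_in W Q (coin_step c False) (bs @ bs') t"
        by (rule Load.IH[OF _ _ _ fits]) (use Load.prems in \<open>simp_all add: coin_step_simps\<close>)
    qed (use Load.prems in \<open>simp_all add: tosses_def\<close>)
  next
    case (Store g a K \<mu> r bs t)
    have g: "g a < V" "g r < V" using Store.prems by (auto simp: fits_def)
    hence fits: "fits g (\<mu>(g a := g r))" using Store.prems Store.hyps(1) by (auto simp: fits_def)
    show ?case
    proof (rule halts_in_Suc[of _ False])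
      show "cost (coin_step c False) \<le> cost c + (1 + 2 * W)"
        using W[OF g(1)] W[OF g(2)] Store.prems by (simp add: coin_step_simps)
      show "halts_in W Q (coin_step c False) (bs @ bs') t"
        by (rule Store.IH[OF _ _ _ fits]) (use Store.prems in \<open>simp_all add: coin_step_simps\<close>)
    qed (use Store.prems in \<open>simp_all add: tosses_def\<close>)
  next
    case (Toss r K g b \<mu> bs t)
    have "of_bool b < V" using \<open>2 \<le> V\<close> by (cases b) auto
    hence fits: "fits (g(r := of_bool b)) \<mu>" using Toss.prems Toss.hyps(1) by (auto simp: fits_def)
    show ?case
    proof (rule halts_in_Suc[of _ b])
      show "cost (coin_step c b) \<le> cost c + (1 + 2 * W)"
        using Toss.prems by (simp add: coin_step_simps)
      show "halts_in W Q (coin_step c b) (bs @ bs') t"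
        by (rule Toss.IH[OF _ _ _ fits]) (use Toss.prems in \<open>simp_all add: coin_step_simps\<close>)
    qed (use Toss.prems in \<open>simp_all add: tosses_def\<close>)
  next
    case (IfNZ g r P1 P2 K \<mu> bs t)
    have g: "g r < V" using IfNZ.prems by (auto simp: fits_def)
    show ?case
    proof (rule halts_in_Suc[of _ False])
      show "cost (coin_step c False) \<le> cost c + (1 + 2 * W)"
        using W[OF g] IfNZ.prems by (simp add: coin_step_simps)
      show "halts_in W Q (coin_step c False) (bs @ bs') t"
        by (rule IfNZ.IH) (use IfNZ.prems in \<open>simp_all add: coin_step_simps\<close>)
    qed (use IfNZ.prems in \<open>simp_all add: tosses_def\<close>)
  next
    case (WhileNZ g r P K \<mu> bs t)
    have g: "g r < V" using WhileNZ.prems by (auto simp: fits_def)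
    show ?case
    proof (rule halts_in_Suc[of _ False])
      show "cost (coin_step c False) \<le> cost c + (1 + 2 * W)"
        using W[OF g] WhileNZ.prems by (simp add: coin_step_simps)
      show "halts_in W Q (coin_step c False) (bs @ bs') t"
        by (rule WhileNZ.IH) (use WhileNZ.prems in \<open>simp_all add: coin_step_simps\<close>)
    qed (use WhileNZ.prems in \<open>simp_all add: tosses_def\<close>)
  qed
qed

lemma space_fits:
  assumes "fits (reg c) (mem c)" "V = 2 ^ W" "A \<le> V"
  shows "space c \<le> R * W + A * (2 * W)"
proof -
  have W: "len x \<le> W" if "x < V" for x
    using that assms by (auto intro: floorlog_leI)
  have supp: "reg c r \<noteq> 0 \<Longrightarrow> r < R" "mem c r \<noteq> 0 \<Longrightarrow> r < A" for r
    using assms(1) unfolding fits_def by (meson not_le)+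
  have "(\<Sum>r | reg c r \<noteq> 0. len (reg c r)) \<le> (\<Sum>r<R. len (reg c r))"
    using supp by (intro sum_mono2) auto
  also have "\<dots> \<le> R * W"
    using sum_bounded_above[of "{..<R}" "\<lambda>r. len (reg c r)" W] assms(1) W by (auto simp: fits_def)
  finally have 1: "(\<Sum>r | reg c r \<noteq> 0. len (reg c r)) \<le> R * W" .
  have "(\<Sum>a | mem c a \<noteq> 0. len a + len (mem c a)) \<le> (\<Sum>a<A. len a + len (mem c a))"
    using supp by (intro sum_mono2) auto
  also have "\<dots> \<le> (\<Sum>a<A. 2 * W)"
  proof (rule sum_mono)
    fix a assume "a \<in> {..<A}"
    hence "a < V" "mem c a < V" using assms(1,3) by (auto simp: fits_def)
    then show "len a + len (mem c a) \<le> 2 * W" using W[of a] W[of "mem c a"] by linarith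
  qed
  finally have 2: "(\<Sum>a | mem c a \<noteq> 0. len a + len (mem c a)) \<le> A * (2 * W)" by simp
  from 1 2 show ?thesis by (simp add: space_def)
qed

text \<open>The bridge from deterministic tapes to the machine model. Every tape of length L leads
  to a halt, which gives the worst-case bounds; those with property \<open>G\<close> lead to
  \<open>Q\<close>, which gives the probability.\<close>

lemma computes_imp_runs:
  assumes comp: "\<And>bs. length bs = L \<Longrightarrow>
      computes (\<lambda>_ \<mu>. G bs \<longrightarrow> Q \<mu>) M (\<lambda>_. 0) (\<lambda>a. if a < length xs then xs ! a else 0) bs t"
    and xs: "length xs \<le> A" "\<And>x. x \<in> set xs \<Longrightarrow> x < V"
    and V: "V = 2 ^ W" "A \<le> V" "2 \<le> V"
  shows "runs_within M xs (real (t * (1 + 2 * W))) (real (R * W + A * (2 * W)))"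
    and "success_prob M xs Q \<ge> measure_pmf.prob (coins L) {bs. G bs}"
proof -
  let ?c = "init M xs"
  have fits: "fits (reg ?c) (mem ?c)"
    using xs V(2,3) by (auto simp: fits_def init_def)
  have *: "fits (reg c') (mem c') \<and> (t \<le> j \<longrightarrow> code c' = [] \<and> cost c' \<le> t * (1 + 2 * W) \<and>
             (G (take L bs) \<longrightarrow> Q (mem c')))"
    if "L \<le> length bs" "c' = tape_run j ?c bs" for bs j c'
  proof -
    have "halts_in W (\<lambda>_ \<mu>. G (take L bs) \<longrightarrow> Q \<mu>) ?c (take L bs @ drop L bs) t"
      using that(1) fits V
      by (intro computes_sound[OF comp[of "take L bs"]]) (simp_all only: length_take min_absorb2, simp_all add: init_def)
    moreover have "cost ?c = 0" by (simp add: init_def)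
    ultimately show ?thesis unfolding halts_in_def that(2) append_take_drop_id by (metis add_0)
  qed
  have 1: "fits (reg c) (mem c) \<and> (t \<le> j \<longrightarrow> code c = [] \<and> cost c \<le> t * (1 + 2 * W))"
    if "c \<in> set_pmf (run j ?c)" for c j
  proof -
    \<comment> \<open>Drawing at least L coins, even for small j, makes the hypothesis on tapes of
      length L applicable to a prefix.\<close>
    have "run j ?c = map_pmf (tape_run j ?c) (coins (max j L))"
      by (rule run_eq_tape_run) simp
    with that obtain bs where "length bs = max j L" "c = tape_run j ?c bs"
      by (auto simp: set_replicate_pmf)
    then show ?thesis using *[of bs c j] by auto
  qed
  show "runs_within M xs (real (t * (1 + 2 * W))) (real (R * W + A * (2 * W)))"
    unfolding runs_within_def of_nat_le_iff
    using 1 space_fits V by blast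
  \<comment> \<open>At this time the run has halted and the tape is long enough to contain L coins.
    The probability at a single time already bounds the supremum from below.\<close>
  let ?j = "max t L" 
  define d where "d = ?j - L"
  have j: "?j = L + d" by (simp add: d_def)
  have take: "map_pmf (take L) (coins (L + d)) = coins L"
    (is "_ = ?r")
  proof -
    have "map_pmf (take L) (coins (L + d)) = 
        bind_pmf (coins L) (\<lambda>xs. bind_pmf (coins d) (\<lambda>ys. return_pmf (take L (xs @ ys))))"
      by (simp add: replicate_pmf_distrib map_bind_pmf)
    also have "\<dots> = bind_pmf (coins L) (\<lambda>xs. bind_pmf (coins d) (\<lambda>ys. return_pmf xs))"
      by (intro bind_pmf_cong refl) (auto simp: set_replicate_pmf)
    also have "\<dots> = coins L" by (simp add: bind_return_pmf')
    finally show ?thesis .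
  qed
  have "measure_pmf.prob (coins L) {bs. G bs} = measure_pmf.prob (coins ?j) {bs. G (take L bs)}"
    unfolding j by (subst take[symmetric]) (simp add: vimage_def)
  also have "\<dots> \<le> measure_pmf.prob (run ?j ?c) {c. code c = [] \<and> Q (mem c)}"
  proof -
    have "measure_pmf.prob (coins ?j) {bs. G (take L bs)} \<le>
       measure_pmf.prob (coins ?j) (tape_run ?j ?c -` {c. code c = [] \<and> Q (mem c)})"
    proof (rule measure_pmf.finite_measure_mono_AE)
      show "AE bs in measure_pmf (coins ?j).
         bs \<in> {bs. G (take L bs)} \<longrightarrow> bs \<in> tape_run ?j ?c -` {c. code c = [] \<and> Q (mem c)}"
        using * by (auto simp: AE_measure_pmf_iff set_replicate_pmf)
    qed simp
    then show ?thesis by (subst run_eq_tape_run[of ?j ?j]) simp_all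
  qed
  also have "\<dots> \<le> success_prob M xs Q"
    unfolding success_prob_def
    by (rule cSUP_upper) (auto intro!: bdd_aboveI[of _ 1] simp: measure_pmf.prob_le_1)
  finally show "success_prob M xs Q \<ge> measure_pmf.prob (coins L) {bs. G bs}" .
qed

end

section \<open>The sampling program\<close>

definition bits :: "nat \<Rightarrow> nat \<Rightarrow> bool list" where
  "bits n z = map (\<lambda>i. odd (z div 2 ^ i)) [0..<n]"

definition from_bits :: "nat \<Rightarrow> bool list \<Rightarrow> nat" where
  "from_bits = foldl (\<lambda>z b. 2 * z + of_bool b)"

text \<open>Each new coin doubles what came before, so the last coin becomes bit 0 and thus the
  value of variable 0. This is the origin of every \<open>rev\<close> applied to a block of coins
  below.\<close>

lemma bits_from_bits: "bits (length bs) (from_bits 0 bs) = rev bs"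
proof (induction bs rule: rev_induct)
  case Nil
  then show ?case by (simp add: bits_def)
next
  case (snoc b bs)
  let ?z = "from_bits 0 bs"
  have z: "from_bits 0 (bs @ [b]) = 2 * ?z + of_bool b" by (simp add: from_bits_def)
  have "odd ((2 * ?z + of_bool b) div 2 ^ Suc i) = odd (?z div 2 ^ i)" for i
    by (simp add: div_mult2_eq)
  then have "bits (Suc (length bs)) (2 * ?z + of_bool b) = b # bits (length bs) ?z"
    unfolding bits_def upt_conv_Cons[OF zero_less_Suc] map_Suc_upt[symmetric] list.map map_map
    by (auto simp: comp_def)
  then show ?case using snoc z by simp
qed

fun stored :: "(nat \<Rightarrow> nat) \<Rightarrow> nat \<Rightarrow> nat list \<Rightarrow> bool" where
  "stored \<mu> p [] \<longleftrightarrow> True"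
| "stored \<mu> p (x # xs) \<longleftrightarrow> \<mu> p = x \<and> stored \<mu> (Suc p) xs"

lemma stored_append: "stored \<mu> p (xs @ ys) \<longleftrightarrow> stored \<mu> p xs \<and> stored \<mu> (p + length xs) ys"
  by (induction xs arbitrary: p) auto

lemma stored_iff: "stored \<mu> p xs \<longleftrightarrow> (\<forall>i<length xs. \<mu> (p + i) = xs ! i)"
  by (induction xs arbitrary: p) (auto simp: less_Suc_eq_0_disj)

fun blocks :: "nat \<Rightarrow> nat \<Rightarrow> 'a list \<Rightarrow> 'a list list" where
  "blocks n 0 bs = []"
| "blocks n (Suc N) bs = take n bs # blocks n N (drop n bs)"

text \<open>
  Assignments are handled as \<open>n\<close>-bit numbers, so the memory is only written at the very end.
  Registers: 2, 3, 4 hold the constants 0, 1, 2; 5 and 6 hold the numbers of variables and clauses;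
  7 counts the remaining samples; 8 is the best assignment so far and 9 a lower bound for its value;
  10 is the current sample, 11 its value, 12 the input pointer, 13 and 14 are loop counters over
  clauses and literals, 15 counts true literals of a clause, 16 to 19 are scratch.
\<close>
definition shift_prog :: instr where
  "shift_prog = WhileNZ 17 [Arith Div 18 18 4, Arith Sub 17 17 3]"

text \<open>
  The encoding of a literal is twice its variable plus its sign, so adding it to the bits of the
  sample from that variable on makes the last bit the truth value of the literal.
\<close>
definition literal_prog :: program where
  "literal_prog = [Load 16 12, Arith Add 12 12 3, Arith Div 17 16 4, Arith Add 18 10 2, shift_prog,
     Arith Add 18 18 16, Arith Div 19 18 4, Arith Mult 19 19 4, Arith Sub 18 18 19,
     Arith Add 15 15 18, Arith Sub 14 14 3]"

definition clause_prog :: program where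
  "clause_prog = [Load 14 12, Arith Add 12 12 3, Const 15 0, WhileNZ 14 literal_prog,
     IfNZ 15 [Arith Add 11 11 3] [], Arith Sub 13 13 3]"

definition sample_prog :: program where
  "sample_prog = [Const 10 0, Arith Add 17 5 2,
     WhileNZ 17 [Toss 16, Arith Mult 10 10 4, Arith Add 10 10 16, Arith Sub 17 17 3]]"

text \<open>Truncated subtraction in register 16 is nonzero exactly if the new sample beats the
  recorded value. Adding register 2, which holds 0, serves as a copy.\<close>

definition round_prog :: program where
  "round_prog = sample_prog @
     [Const 11 0, Const 12 2, Arith Add 13 6 2, WhileNZ 13 clause_prog,
      Arith Sub 16 11 9, IfNZ 16 [Arith Add 9 11 2, Arith Add 8 10 2] [], Arith Sub 7 7 3]"

text \<open>Numerator and denominator of (P / Q)^n are built separately, so rounding happens only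
  once, in the single division.\<close>

definition budget_prog :: "nat \<Rightarrow> nat \<Rightarrow> nat \<Rightarrow> program" where
  "budget_prog P Q C = [Const 16 1, Const 17 1, Const 18 P, Const 19 Q, Arith Add 13 5 2,
     WhileNZ 13 [Arith Mult 16 16 18, Arith Mult 17 17 19, Arith Sub 13 13 3],
     Arith Div 7 16 17, Arith Add 7 7 3, Const 18 C, Arith Mult 7 7 18,
     Arith Add 18 5 3, Arith Mult 7 7 18]"

definition output_prog :: program where
  "output_prog = [Const 10 0, Arith Add 13 5 2,
     WhileNZ 13 [Arith Div 16 8 4, Arith Mult 17 16 4, Arith Sub 17 8 17, Store 10 17,
       Arith Add 8 16 2, Arith Add 10 10 3, Arith Sub 13 13 3]]"

text \<open>Register 2 is never written and keeps its initial 0, so the two loads read cells 0 and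
  1. Registers 8 and 9 also start at 0: the all-false assignment with the trivially correct lower
  bound 0.\<close>

definition search_prog :: "nat \<Rightarrow> nat \<Rightarrow> nat \<Rightarrow> program" where
  "search_prog P Q C = [Const 3 1, Const 4 2, Load 5 2, Load 6 3] @ budget_prog P Q C @
     WhileNZ 7 round_prog # output_prog"

text \<open>The size conditions cover all numbers that arise: samples below \<open>2 ^ n\<close>, a
  shifted sample plus a literal code of at most \<open>2 * n\<close>, input pointers and counters
  bounded by the length of the encoding, and the powers and products formed while computing the
  number of samples.\<close>

locale search_ram = bounded_ram 20 V A for V A :: nat +
  fixes n :: nat and f :: formula and P Q C :: nat
  assumes vars: "\<And>cl l. cl \<in> set f \<Longrightarrow> l \<in> set cl \<Longrightarrow> var l < n"
    and room: "2 ^ n + 2 * n + length (enc_instance n f) + P + Q + C + 4 \<le> V"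
    and room_pow: "P ^ n + 1 < V" "Q ^ n < V" "C * (n + 1) * (P ^ n + 1) < V"
    and PQ_pos: "0 < P" "0 < Q"
    and n_le_A: "n \<le> A"
begin

section \<open>Evaluation of a sample\<close>

definition const_regs :: "(nat \<Rightarrow> nat) \<Rightarrow> bool" where
  "const_regs g \<longleftrightarrow> g 2 = 0 \<and> g 3 = 1 \<and> g 4 = 2"

lemma computes_shift_prog:
  assumes "const_regs g" "computes X K (g(18 := g 18 div 2 ^ g 17, 17 := 0)) \<mu> bs t"
  shows "computes X (shift_prog # K) g \<mu> bs (t + 3 * g 17 + 1)"
  using assms
proof (induction "g 17" arbitrary: g)
  case 0
  then have "g(17 := 0) = g" by auto
  with 0 show ?case unfolding shift_prog_def
    by (subst computes_WhileNZ) simp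
next
  case (Suc v)
  let ?g = "g(18 := g 18 div 2, 17 := g 17 - 1)"
  have v: "g 17 = Suc v" "?g 17 = v" by (simp_all flip: Suc.hyps(2))
  have "?g(18 := ?g 18 div 2 ^ ?g 17, 17 := 0) = g(18 := g 18 div 2 ^ g 17, 17 := 0)"
    using v by (simp add: div_mult2_eq)
  then have "computes X (shift_prog # K) ?g \<mu> bs (t + 3 * ?g 17 + 1)"
    by (intro Suc.hyps(1)) (use Suc.prems v in \<open>simp_all only: const_regs_def, simp_all\<close>)
  then show ?case
    using Suc.prems(1) v unfolding shift_prog_def
    by (subst computes_WhileNZ) (simp add: const_regs_def)
qed

text \<open>The rule is in continuation form, as are those for the larger fragments: the effect of
  the fragment appears as what may be assumed when the remaining code \<open>K\<close> starts.
  Fragments then compose by applying the rules backwards, and their times add up.\<close>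

lemma computes_literal_prog:
  assumes "const_regs g" "\<mu> (g 12) = enc_literal l" "var l < n"
    and "g 12 + 1 < V" "g 15 + 1 < V" "g 10 < 2 ^ n"
    and K: "\<And>g'. (\<And>r. r < 12 \<or> r = 13 \<Longrightarrow> g' r = g r) \<Longrightarrow> g' 12 = g 12 + 1 \<Longrightarrow> g' 14 = g 14 - 1 \<Longrightarrow>
      g' 15 = g 15 + of_bool (sat_literal (bits n (g 10)) l) \<Longrightarrow> computes X K g' \<mu> bs t"
  shows "computes X (literal_prog @ K) g \<mu> bs (t + 3 * n + 12)"
proof -
  let ?e = "enc_literal l"
  have e: "?e div 2 = var l" "?e \<le> 2 * n" using assms(3) by (cases l; simp)+
  have shift_le: "g 10 div 2 ^ var l < 2 ^ n" using assms(6) by (meson div_le_dividend le_less_trans)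
  have twice: "x div 2 * 2 < V" if "x < V" for x :: nat
    using that by (metis div_times_less_eq_dividend le_less_trans)
  define g1 where "g1 = g(16 := ?e, 12 := g 12 + 1, 17 := var l, 18 := g 10)"
  define w where "w = g 10 div 2 ^ var l + ?e"
  have w: "w < V" using shift_le e(2) room by (simp add: w_def)
  have sat: "w - w div 2 * 2 = of_bool (sat_literal (bits n (g 10)) l)"
    unfolding minus_div_mult_eq_mod using assms(3)
    by (cases l) (auto simp: w_def bits_def mod2_eq_if)
  have rest: "computes X ([Arith Add 18 18 16, Arith Div 19 18 4, Arith Mult 19 19 4, Arith Sub 18 18 19,
     Arith Add 15 15 18, Arith Sub 14 14 3] @ K) (g1(18 := g1 18 div 2 ^ g1 17, 17 := 0)) \<mu> bs (t + 6)"
    using assms(1,5) w twice[OF w] sat 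
    by (auto simp: g1_def const_regs_def w_def[symmetric] intro!: computes_mono[OF K])
  have "computes X (shift_prog # [Arith Add 18 18 16, Arith Div 19 18 4, Arith Mult 19 19 4, Arith Sub 18 18 19,
     Arith Add 15 15 18, Arith Sub 14 14 3] @ K) g1 \<mu> bs (t + 6 + 3 * g1 17 + 1)"
    by (rule computes_shift_prog[OF _ rest]) (use assms(1) in \<open>simp add: const_regs_def g1_def\<close>)
  then have "computes X (shift_prog # [Arith Add 18 18 16, Arith Div 19 18 4, Arith Mult 19 19 4, Arith Sub 18 18 19,
     Arith Add 15 15 18, Arith Sub 14 14 3] @ K) g1 \<mu> bs (t + 3 * n + 8)"
    by (rule computes_mono) (use assms(3) in \<open>simp add: g1_def\<close>)
  then show ?thesis
    using assms(1-6) e room by (auto simp: literal_prog_def const_regs_def g1_def elim: computes_mono)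
qed

text \<open>Register 15 is arbitrary at the start because true literals seen earlier have
  accumulated there. Afterwards only whether it is zero matters.\<close>

lemma computes_literals:
  assumes "const_regs g" "stored \<mu> (g 12) (map enc_literal ls)" "\<And>l. l \<in> set ls \<Longrightarrow> var l < n"
    and "g 14 = length ls" "g 12 + length ls < V" "g 15 + length ls < V" "g 10 < 2 ^ n"
    and "\<And>g'. (\<And>r. r < 12 \<or> r = 13 \<Longrightarrow> g' r = g r) \<Longrightarrow> g' 12 = g 12 + length ls \<Longrightarrow>
      (g' 15 = 0 \<longleftrightarrow> g 15 = 0 \<and> \<not> sat_clause (bits n (g 10)) ls) \<Longrightarrow> computes X K g' \<mu> bs t"
  shows "computes X (WhileNZ 14 literal_prog # K) g \<mu> bs (t + length ls * (3 * n + 13) + 1)"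
  using assms
proof (induction ls arbitrary: g)
  case Nil
  then show ?case by (subst computes_WhileNZ) (auto simp: sat_clause_def)
next
  case (Cons l ls)
  have "computes X (literal_prog @ WhileNZ 14 literal_prog # K) g \<mu> bs
      (t + length ls * (3 * n + 13) + 1 + 3 * n + 12)"
  proof (rule computes_literal_prog[of _ _ l], goal_cases)
    case (7 g')
    show ?case
    proof (rule Cons.IH, goal_cases)
      case (8 h)
      show ?case
        by (rule Cons.prems(8)) (use 7 8 in \<open>auto simp: sat_clause_def\<close>)
    qed (use Cons.prems(1-7) 7 in \<open>auto simp: const_regs_def\<close>)
  qed (use Cons.prems(1-7) in auto)
  then show ?case using Cons.prems(4)
    by (subst computes_WhileNZ) (auto elim: computes_mono)
qed

lemma computes_clause_prog:
  assumes "const_regs g" "stored \<mu> (g 12) (length cl # map enc_literal cl)" "\<And>l. l \<in> set cl \<Longrightarrow> var l < n"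
    and "g 12 + 1 + length cl < V" "g 11 + 1 < V" "g 10 < 2 ^ n"
    and K: "\<And>g'. (\<And>r. r < 11 \<Longrightarrow> g' r = g r) \<Longrightarrow> g' 12 = g 12 + 1 + length cl \<Longrightarrow> g' 13 = g 13 - 1 \<Longrightarrow>
      g' 11 = g 11 + of_bool (sat_clause (bits n (g 10)) cl) \<Longrightarrow> computes X K g' \<mu> bs t"
  shows "computes X (clause_prog @ K) g \<mu> bs (t + length cl * (3 * n + 13) + 7)"
proof -
  let ?g = "g(14 := length cl, 12 := g 12 + 1, 15 := 0)"
  have "computes X (WhileNZ 14 literal_prog # IfNZ 15 [Arith Add 11 11 3] [] # Arith Sub 13 13 3 # K) ?g \<mu> bs
          (t + 3 + length cl * (3 * n + 13) + 1)"
  proof (rule computes_literals, goal_cases)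
    case (8 g')
    then show ?case using assms(1,5) by (auto simp: const_regs_def intro!: computes_mono[OF K])
  qed (use assms(1-6) in \<open>auto simp: const_regs_def\<close>)
  then show ?thesis
    using assms(1-6) room by (auto simp: clause_prog_def const_regs_def algebra_simps elim: computes_mono)
qed

text \<open>The induction runs over the clauses not yet read, hence a list \<open>fs\<close> with
  clauses from \<open>f\<close> and an input pointer at an arbitrary position.\<close>

lemma computes_clauses:
  assumes "const_regs g" "stored \<mu> (g 12) (concat (map (\<lambda>cl. length cl # map enc_literal cl) fs))"
    and "set fs \<subseteq> set f" "g 13 = length fs"
    and "g 12 + length (concat (map (\<lambda>cl. length cl # map enc_literal cl) fs)) < V"
    and "g 11 + length fs < V" "g 10 < 2 ^ n"
    and "\<And>g'. (\<And>r. r < 11 \<Longrightarrow> g' r = g r) \<Longrightarrow> g' 11 = g 11 + num_sat fs (bits n (g 10)) \<Longrightarrow>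
      computes X K g' \<mu> bs t"
  shows "computes X (WhileNZ 13 clause_prog # K) g \<mu> bs
           (t + (\<Sum>cl\<leftarrow>fs. length cl * (3 * n + 13) + 8) + 1)"
  using assms
proof (induction fs arbitrary: g)
  case Nil
  then show ?case by (subst computes_WhileNZ) (auto simp: num_sat_def)
next
  case (Cons cl fs)
  have "computes X (clause_prog @ WhileNZ 13 clause_prog # K) g \<mu> bs
      (t + (\<Sum>cl\<leftarrow>fs. length cl * (3 * n + 13) + 8) + 1 + length cl * (3 * n + 13) + 7)"
  proof (rule computes_clause_prog, goal_cases)
    case (7 g')
    show ?case
    proof (rule Cons.IH, goal_cases)
      case (8 h)
      show ?case
        by (rule Cons.prems(8)) (use 7 8 in \<open>auto simp: num_sat_def\<close>)
    qed (use Cons.prems(1-7) 7 in \<open>auto simp: const_regs_def stored_append add_ac\<close>)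
  qed (use Cons.prems(1-7) vars in \<open>auto simp: stored_append\<close>)
  then show ?case using Cons.prems(4)
    by (subst computes_WhileNZ) (auto elim: computes_mono)
qed

section \<open>Sampling and the main loop\<close>

lemma computes_sampling:
  assumes "const_regs g" "length bs = g 17" "(g 10 + 1) * 2 ^ length bs \<le> V"
    and "\<And>g'. (\<And>r. r < 10 \<Longrightarrow> g' r = g r) \<Longrightarrow> g' 10 = from_bits (g 10) bs \<Longrightarrow>
      g' 10 < (g 10 + 1) * 2 ^ length bs \<Longrightarrow> computes X K g' \<mu> bs' t"
  shows "computes X (WhileNZ 17 [Toss 16, Arith Mult 10 10 4, Arith Add 10 10 16, Arith Sub 17 17 3] # K)
           g \<mu> (bs @ bs') (t + length bs * 5 + 1)"
  using assms
proof (induction bs arbitrary: g)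
  case Nil
  then show ?case by (subst computes_WhileNZ) (auto simp: from_bits_def)
next
  case (Cons b bs)
  let ?g = "g(16 := of_bool b, 10 := g 10 * 2 + of_bool b, 17 := g 17 - 1)"
  \<comment> \<open>With z in register 10 and a coin b, 2 z + b + 1 \<le> 2 (z + 1). So this product
    does not grow while coins are consumed, and it bounds all partial samples.\<close>
  have le: "(?g 10 + 1) * 2 ^ length bs \<le> (g 10 + 1) * 2 ^ length (b # bs)"
    by (cases b) (auto simp: algebra_simps)
  have "(g 10 + 1) * 2 \<le> (g 10 + 1) * 2 ^ length (b # bs)"
    by (rule mult_le_mono2) simp
  then have small: "g 10 * 2 + 1 < V" using Cons.prems(3) by simp
  have "computes X (WhileNZ 17 [Toss 16, Arith Mult 10 10 4, Arith Add 10 10 16, Arith Sub 17 17 3] # K)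
           ?g \<mu> (bs @ bs') (t + length bs * 5 + 1)"
  proof (rule Cons.IH, goal_cases)
    case 3
    show ?case using le Cons.prems(3) by (rule le_trans)
  next
    case (4 h)
    show ?case
    proof (rule Cons.prems(4))
      show "h 10 < (g 10 + 1) * 2 ^ length (b # bs)" using 4(3) le by simp
    qed (use 4 in \<open>auto simp: from_bits_def mult.commute\<close>)
  qed (use Cons.prems(1,2) in \<open>auto simp: const_regs_def\<close>)
  then show ?case using Cons.prems(1,2) small
    by (subst computes_WhileNZ) (cases b; auto simp: const_regs_def elim!: computes_mono)
qed

definition round_time :: nat where
  "round_time = (\<Sum>cl\<leftarrow>f. length cl * (3 * n + 13) + 8) + 5 * n + 15"

lemma length_enc_instance:
  "length (enc_instance n f) = 2 + length (concat (map (\<lambda>cl. length cl # map enc_literal cl) f))"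
  by (simp add: enc_instance_def)

lemma length_le_enc: "length f \<le> length (concat (map (\<lambda>cl. length cl # map enc_literal cl) f))"
  by (induction f) auto

lemma computes_round_prog:
  assumes g: "const_regs g" "g 5 = n" "g 6 = length f" and bs: "length bs = n"
    and stored: "stored \<mu> 0 (enc_instance n f)"
    and best: "g 9 \<le> num_sat f (bits n (g 8))" "g 8 < 2 ^ n"
    and K: "\<And>g'. const_regs g' \<Longrightarrow> g' 5 = n \<Longrightarrow> g' 6 = length f \<Longrightarrow> g' 7 = g 7 - 1 \<Longrightarrow>
      g' 9 \<le> num_sat f (bits n (g' 8)) \<Longrightarrow> g' 8 < 2 ^ n \<Longrightarrow> g 9 \<le> g' 9 \<Longrightarrow> num_sat f (rev bs) \<le> g' 9 \<Longrightarrow>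
      computes X K g' \<mu> bs' t"
  shows "computes X (round_prog @ K) g \<mu> (bs @ bs') (t + round_time)"
proof -
  define K1 where "K1 = [Arith Sub 16 11 9, IfNZ 16 [Arith Add 9 11 2, Arith Add 8 10 2] [], Arith Sub 7 7 3] @ K"
  have small: "num_sat f z < V" for z
  proof -
    have "num_sat f z \<le> length f" by (simp add: num_sat_def)
    then show ?thesis using room length_le_enc by (simp add: length_enc_instance)
  qed
  define T where "T = (\<Sum>cl\<leftarrow>f. length cl * (3 * n + 13) + 8)"
  define T' where "T' = T + 5 * n + 13"
  let ?g = "g(10 := 0, 17 := n)"
  have "computes X (WhileNZ 17 [Toss 16, Arith Mult 10 10 4, Arith Add 10 10 16, Arith Sub 17 17 3] #
      [Const 11 0, Const 12 2, Arith Add 13 6 2, WhileNZ 13 clause_prog] @ K1) ?g \<mu> (bs @ bs')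
      (t + T + 9 + length bs * 5 + 1)"
  proof (rule computes_sampling, goal_cases)
    case (4 h)
    have h10: "h 10 < 2 ^ n" using 4(3) bs by simp
    have h: "r < 10 \<Longrightarrow> h r = g r" for r using 4(1)[of r] by simp
    have bits: "bits n (h 10) = rev bs" using 4(2) bits_from_bits[of bs] bs by simp
    let ?h = "h(11 := 0, 12 := 2, 13 := length f)"
    have "computes X (WhileNZ 13 clause_prog # K1) ?h \<mu> bs' (t + 5 + T + 1)"
      unfolding T_def
    proof (rule computes_clauses, goal_cases)
      case 2
      show ?case using stored by (simp add: enc_instance_def numeral_2_eq_2)
    next
      case (8 h')
      have h': "r < 10 \<Longrightarrow> h' r = g r" for r using 8(1)[of r] h by simp
      have "h' 11 = num_sat f (rev bs)" "h' 10 = h 10" using 8 bits by auto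
      then show ?case
        using g h' best small[of "rev bs"] bits h10 room unfolding K1_def
        by (auto simp: const_regs_def intro!: computes_mono[OF K])
    qed (use h g room h10 length_le_enc in \<open>auto simp: const_regs_def length_enc_instance\<close>)
    then show ?case
      using h g room length_le_enc by (simp add: const_regs_def length_enc_instance)
  qed (use g bs room in \<open>auto simp: const_regs_def\<close>)
  then have "computes X (WhileNZ 17 [Toss 16, Arith Mult 10 10 4, Arith Add 10 10 16, Arith Sub 17 17 3] #
      [Const 11 0, Const 12 2, Arith Add 13 6 2, WhileNZ 13 clause_prog] @ K1) ?g \<mu> (bs @ bs')
      (t + T')"
    by (rule computes_mono) (simp add: bs T'_def)
  moreover have "round_time = T' + 2" by (simp add: round_time_def T_def T'_def)
  ultimately show ?thesis
    using g room by (simp add: round_prog_def sample_prog_def const_regs_def K1_def)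
qed

text \<open>The continuation may also assume that the final assignment reaches the initial bound in
  register 9. This carries the values of earlier samples, which are at most that bound, through the
  later rounds.\<close>

lemma computes_rounds:
  assumes "const_regs g" "g 5 = n" "g 6 = length f" "length bs = g 7 * n"
    and "stored \<mu> 0 (enc_instance n f)" "g 9 \<le> num_sat f (bits n (g 8))" "g 8 < 2 ^ n"
    and "\<And>g'. const_regs g' \<Longrightarrow> g' 5 = n \<Longrightarrow> g' 8 < 2 ^ n \<Longrightarrow> g 9 \<le> num_sat f (bits n (g' 8)) \<Longrightarrow>
      (\<forall>b\<in>set (blocks n (g 7) bs). num_sat f (rev b) \<le> num_sat f (bits n (g' 8))) \<Longrightarrow>
      computes X K g' \<mu> bs' t"
  shows "computes X (WhileNZ 7 round_prog # K) g \<mu> (bs @ bs') (t + g 7 * (round_time + 1) + 1)"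
  using assms
proof (induction "g 7" arbitrary: g bs)
  case 0
  then show ?case by (subst computes_WhileNZ) simp
next
  case (Suc N)
  have len: "length (take n bs) = n" "length (drop n bs) = N * n"
    using Suc.prems(4) by (simp_all flip: Suc.hyps(2))
  have "computes X (round_prog @ WhileNZ 7 round_prog # K) g \<mu> (take n bs @ drop n bs @ bs')
     (t + N * (round_time + 1) + 1 + round_time)"
  proof (rule computes_round_prog, goal_cases)
    case (8 g')
    have N: "N = g' 7" using 8(4) by (simp flip: Suc.hyps(2))
    show ?case unfolding N
    proof (rule Suc.hyps(1), goal_cases)
      case (9 h)
      show ?case
        by (rule Suc.prems(8)) (use 8 9 N in \<open>auto simp flip: Suc.hyps(2)\<close>)
    qed (use Suc.prems(1-7) 8 len N in auto)
  qed (use Suc.prems(1-7) len in auto)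
  then have "computes X (round_prog @ WhileNZ 7 round_prog # K) g \<mu> (bs @ bs')
     (t + N * (round_time + 1) + 1 + round_time)"
    by (simp only: append_assoc[symmetric] append_take_drop_id)
  then show ?case
    by (subst computes_WhileNZ) (simp flip: Suc.hyps(2) add: add_ac)
qed


section \<open>Computing the number of samples\<close>

lemma computes_budget_loop:
  assumes "const_regs g" "g 5 = n" "g 18 = P" "g 19 = Q" "g 16 = P ^ (n - g 13)" "g 17 = Q ^ (n - g 13)"
    and "g 13 \<le> n"
    and "\<And>g'. (\<And>r. r < 13 \<Longrightarrow> g' r = g r) \<Longrightarrow> g' 16 = P ^ n \<Longrightarrow> g' 17 = Q ^ n \<Longrightarrow> computes X K g' \<mu> bs t"
  shows "computes X (WhileNZ 13 [Arith Mult 16 16 18, Arith Mult 17 17 19, Arith Sub 13 13 3] # K)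
           g \<mu> bs (t + g 13 * 4 + 1)"
  using assms
proof (induction "g 13" arbitrary: g)
  case 0
  then show ?case by (subst computes_WhileNZ) simp
next
  case (Suc v)
  let ?g = "g(16 := g 16 * P, 17 := g 17 * Q, 13 := g 13 - 1)"
  have d: "n - v = Suc (n - Suc v)" "Suc v \<le> n" using Suc.prems(7) by (simp_all flip: Suc.hyps(2))
  have pows: "g 16 * P = P ^ (n - v)" "g 17 * Q = Q ^ (n - v)"
    using Suc.prems(5,6) by (simp_all add: d(1) mult.commute flip: Suc.hyps(2))
  have "P ^ (n - v) \<le> P ^ n" "Q ^ (n - v) \<le> Q ^ n"
    using PQ_pos by (intro power_increasing; simp)+
  then have small: "g 16 * P < V" "g 17 * Q < V" using room_pow pows by auto
  have v: "?g 13 = v" by (simp flip: Suc.hyps(2))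
  have "computes X (WhileNZ 13 [Arith Mult 16 16 18, Arith Mult 17 17 19, Arith Sub 13 13 3] # K)
           ?g \<mu> bs (t + ?g 13 * 4 + 1)"
  proof (rule Suc.hyps(1), goal_cases)
    case (9 g')
    then show ?case by (intro Suc.prems(8)) auto
  qed (use Suc.prems(1-7) pows d(2) v in \<open>auto simp: const_regs_def simp flip: Suc.hyps(2)\<close>)
  then show ?case
    using Suc.prems small v by (subst computes_WhileNZ) (simp add: const_regs_def flip: Suc.hyps(2))
qed

lemma computes_budget_prog:
  assumes "const_regs g" "g 5 = n"
    and K: "\<And>g'. (\<And>r. r < 7 \<or> r = 8 \<or> r = 9 \<Longrightarrow> g' r = g r) \<Longrightarrow> g' 7 = C * (n + 1) * (P ^ n div Q ^ n + 1) \<Longrightarrow>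
      computes X K g' \<mu> bs t"
  shows "computes X (budget_prog P Q C @ K) g \<mu> bs (t + n * 4 + 12)"
proof -
  define K1 where "K1 = [Arith Div 7 16 17, Arith Add 7 7 3, Const 18 C, Arith Mult 7 7 18,
     Arith Add 18 5 3, Arith Mult 7 7 18] @ K"
  define q where "q = P ^ n div Q ^ n"
  \<comment> \<open>Bounding the quotient by \<open>P ^ n\<close> reduces every overflow condition
    here to \<open>room_pow\<close> and \<open>room\<close>.\<close>
  have q: "q + 1 \<le> P ^ n + 1" by (simp add: q_def)
  then have "C * (n + 1) * (q + 1) \<le> C * (n + 1) * (P ^ n + 1)" by (rule mult_le_mono2)
  then have "C * (n + 1) * (q + 1) < V" using room_pow(3) by (rule le_less_trans)
  moreover have N: "C * (n + 1) * (q + 1) = (q + 1) * C * (n + 1)" by (simp only: ac_simps)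
  ultimately have 1: "(q + 1) * C * (n + 1) < V" by (simp only:)
  have 2: "(q + 1) * C < V" by (rule le_less_trans[OF _ 1]) simp
  have 3: "q + 1 < V" using room_pow(1) q by linarith
  have K': "computes X K g' \<mu> bs t"
    if "\<And>r. r < 7 \<or> r = 8 \<or> r = 9 \<Longrightarrow> g' r = g r" "g' 7 = (q + 1) * C * (n + 1)" for g'
    by (rule K) (use that in \<open>simp_all only: q_def[symmetric] N\<close>)
  let ?g = "g(16 := 1, 17 := 1, 18 := P, 19 := Q, 13 := n)"
  have "computes X (WhileNZ 13 [Arith Mult 16 16 18, Arith Mult 17 17 19, Arith Sub 13 13 3] # K1)
     ?g \<mu> bs (t + 6 + ?g 13 * 4 + 1)"
  proof (rule computes_budget_loop, goal_cases)
    case (8 g')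
    have "computes X K (g'(18 := n + 1, 7 := (q + 1) * C * (n + 1))) \<mu> bs t"
      by (rule K') (use 8 in auto)
    with 8 show ?case using assms(1,2) 1 2 3 room
      by (simp add: K1_def const_regs_def q_def[symmetric])
  qed (use assms in \<open>auto simp: const_regs_def\<close>)
  then show ?thesis
    using assms room by (simp add: budget_prog_def K1_def const_regs_def)
qed


section \<open>Output and the complete program\<close>

lemma computes_output_loop:
  assumes "const_regs g" "g 10 + g 13 = n" "g 8 < 2 ^ n"
    and "\<And>g' \<mu>'. (\<And>a. a < n \<Longrightarrow> \<mu>' a = (if a < g 10 then \<mu> a else g 8 div 2 ^ (a - g 10) mod 2)) \<Longrightarrow>
      computes X K g' \<mu>' bs t"
  shows "computes X (WhileNZ 13 [Arith Div 16 8 4, Arith Mult 17 16 4, Arith Sub 17 8 17, Store 10 17,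
       Arith Add 8 16 2, Arith Add 10 10 3, Arith Sub 13 13 3] # K) g \<mu> bs (t + g 13 * 8 + 1)"
  using assms
proof (induction "g 13" arbitrary: g \<mu>)
  case 0
  then show ?case by (subst computes_WhileNZ) simp
next
  case (Suc v)
  let ?b = "g 8 mod 2"
  let ?g = "g(16 := g 8 div 2, 17 := ?b, 8 := g 8 div 2, 10 := g 10 + 1, 13 := g 13 - 1)"
  let ?\<mu> = "\<mu>(g 10 := ?b)"
  have v: "?g 13 = v" "g 13 = Suc v" by (simp_all flip: Suc.hyps(2))
  have half: "g 8 div 2 < 2 ^ n" using Suc.prems(3) by (meson div_le_dividend le_less_trans)
  have b: "g 8 - g 8 div 2 * 2 = ?b" by (simp add: minus_div_mult_eq_mod)
  have "computes X (WhileNZ 13 [Arith Div 16 8 4, Arith Mult 17 16 4, Arith Sub 17 8 17, Store 10 17,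
       Arith Add 8 16 2, Arith Add 10 10 3, Arith Sub 13 13 3] # K) ?g ?\<mu> bs (t + ?g 13 * 8 + 1)"
  proof (rule Suc.hyps(1), goal_cases)
    case (5 \<mu>' g')
    show ?case
    proof (rule Suc.prems(4))
      fix a assume "a < n"
      consider "a < g 10" | "a = g 10" | "g 10 < a" by linarith
      then show "\<mu>' a = (if a < g 10 then \<mu> a else g 8 div 2 ^ (a - g 10) mod 2)"
      proof cases
        case 3
        then have "a - g 10 = Suc (a - (g 10 + 1))" by simp
        then have "g 8 div 2 ^ (a - g 10) = g 8 div 2 div 2 ^ (a - (g 10 + 1))"
          by (simp only: power_Suc div_mult2_eq)
        with 3 show ?thesis using 5[OF \<open>a < n\<close>] by simp
      qed (use 5[OF \<open>a < n\<close>] in simp_all)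
    qed
  qed (use Suc.prems(1,2) v half in \<open>simp_all add: const_regs_def\<close>)
  moreover have "g 8 div 2 * 2 < V" 
    using room Suc.prems(3) div_times_less_eq_dividend[of "g 8" 2] by linarith
  moreover have "g 10 < A" "g 10 + 1 < V" using Suc.prems(2) n_le_A room v(2) by linarith+
  ultimately show ?case
    using Suc.prems(1) v(2) b by (subst computes_WhileNZ) (simp add: const_regs_def)
qed

lemma computes_search_prog:
  assumes stored: "stored \<mu> 0 (enc_instance n f)"
    and bs: "length bs = C * (n + 1) * (P ^ n div Q ^ n + 1) * n"
  shows "computes (\<lambda>_ \<mu>'. \<forall>b\<in>set (blocks n (C * (n + 1) * (P ^ n div Q ^ n + 1)) bs).
           num_sat f (rev b) \<le> num_sat f (out_assignment n \<mu>'))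
    (search_prog P Q C) (\<lambda>_. 0) \<mu> bs
    (C * (n + 1) * (P ^ n div Q ^ n + 1) * (round_time + 1) + 12 * n + 20)" (is "computes ?X _ _ _ _ _")
proof -
  let ?N = "C * (n + 1) * (P ^ n div Q ^ n + 1)"
  have \<mu>: "\<mu> 0 = n" "\<mu> 1 = length f" using stored by (simp_all add: enc_instance_def)
  let ?g = "(\<lambda>_. 0::nat)(3 := 1, 4 := 2, 5 := n, 6 := length f)"
  define T where "T = 3 + n * 8 + ?N * (round_time + 1) + 1 + n * 4 + 12"
  have budget: "computes ?X (budget_prog P Q C @ WhileNZ 7 round_prog # output_prog) ?g \<mu> bs T"
    unfolding T_def
  proof (rule computes_budget_prog, goal_cases)
    case (3 g)
    have "computes ?X (WhileNZ 7 round_prog # output_prog) g \<mu> (bs @ []) (3 + n * 8 + g 7 * (round_time + 1) + 1)"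
    proof (rule computes_rounds, goal_cases)
      case (8 h)
      let ?h = "h(10 := 0, 13 := n)"
      have "computes ?X (WhileNZ 13 [Arith Div 16 8 4, Arith Mult 17 16 4, Arith Sub 17 8 17, Store 10 17,
       Arith Add 8 16 2, Arith Add 10 10 3, Arith Sub 13 13 3] # []) ?h \<mu> [] (0 + ?h 13 * 8 + 1)"
      proof (rule computes_output_loop, goal_cases)
        case (4 h' \<mu>')
        have "out_assignment n \<mu>' = bits n (h 8)"
          using 4 by (auto simp: out_assignment_def bits_def odd_iff_mod_2_eq_one)
        then show ?case using 8(5) 3(2) by simp
      qed (use 8 in \<open>auto simp: const_regs_def\<close>)
      then show ?case
        using 8 room by (simp add: output_prog_def const_regs_def)
    qed (use 3 bs stored in \<open>auto simp: const_regs_def\<close>)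
    then show ?case by (simp add: 3(2))
  qed (auto simp: const_regs_def)
  define K where "K = budget_prog P Q C @ WhileNZ 7 round_prog # output_prog"
  have "2 < V" "1 < V" using room by simp_all
  then have "computes ?X ([Const 3 1, Const 4 2, Load 5 2, Load 6 3] @ K) (\<lambda>_. 0) \<mu> bs (T + 4)"
    using budget \<mu> unfolding K_def[symmetric] by simp
  then show ?thesis
    unfolding search_prog_def K_def by (rule computes_mono) (simp add: T_def)
qed

end

section \<open>Counting good assignments\<close>

lemma coins_eq_pmf_of_set: "coins n = pmf_of_set {bs. length bs = n}"
proof (rule pmf_eqI)
  fix bs :: "bool list"
  have fin: "finite {bs :: bool list. length bs = n}" for n
    using finite_lists_length_eq[of "UNIV :: bool set" n] by simp
  have card: "card {bs :: bool list. length bs = n} = 2 ^ n" for n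
    using card_lists_length_eq[of "UNIV :: bool set" n] by simp
  have ne: "{bs :: bool list. length bs = n} \<noteq> {}" for n
    using Ex_list_of_length by auto
  have "pmf (coins n) bs = (if length bs = n then (1 / 2) ^ n else 0)"
  proof (induction n arbitrary: bs)
    case 0
    then show ?case by (simp add: pmf_return)
  next
    case (Suc n)
    have coins: "coins (Suc n) = map_pmf (\<lambda>(x, xs). x # xs) (pair_pmf (bernoulli_pmf (1/2)) (coins n))"
      by (simp add: pair_pmf_def map_bind_pmf)
    show ?case
    proof (cases bs)
      case Nil
      have "[] \<notin> set_pmf (coins (Suc n))" by (simp add: set_replicate_pmf)
      then show ?thesis using Nil by (simp add: pmf_eq_0_set_pmf)
    next
      case (Cons b bs')
      have "pmf (coins (Suc n)) ((\<lambda>(x, xs). x # xs) (b, bs')) =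
          pmf (pair_pmf (bernoulli_pmf (1/2)) (coins n)) (b, bs')"
        unfolding coins by (rule pmf_map_inj') (auto simp: inj_def)
      then show ?thesis using Cons Suc.IH[of bs'] by (auto simp: pmf_pair simp del: replicate_pmf.simps)
    qed
  qed
  then show "pmf (coins n) bs = pmf (pmf_of_set {bs. length bs = n}) bs"
    by (simp add: pmf_of_set[OF ne fin] card power_one_over indicator_def)
qed

lemma prob_coins:
  "measure_pmf.prob (coins n) {bs. G bs} = card {bs. length bs = n \<and> G bs} / 2 ^ n"
proof -
  have "finite {bs :: bool list. length bs = n}"
    using finite_lists_length_eq[of "UNIV :: bool set" n] by simp
  moreover have "card {bs :: bool list. length bs = n} = 2 ^ n"
    using card_lists_length_eq[of "UNIV :: bool set" n] by simp
  moreover have "{bs :: bool list. length bs = n} \<noteq> {}"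
    using Ex_list_of_length by auto
  ultimately show ?thesis
    by (simp add: coins_eq_pmf_of_set measure_pmf_of_set Collect_conj_eq)
qed

text \<open>The first n coins are independent of the remaining ones, so the probability of a common
  property of all blocks factorizes.\<close>

lemma prob_all_blocks:
  "measure_pmf.prob (coins (N * n)) {bs. \<forall>b\<in>set (blocks n N bs). G b}
     = measure_pmf.prob (coins n) {b. G b} ^ N"
proof (induction N)
  case 0
  then show ?case by (simp add: indicator_def)
next
  case (Suc N)
  let ?all = "\<lambda>N bs. \<forall>b\<in>set (blocks n N bs). G b"
  have coins: "coins (n + N * n) = map_pmf (\<lambda>(x, y). x @ y) (pair_pmf (coins n) (coins (N * n)))"
    by (simp add: replicate_pmf_distrib pair_pmf_def map_bind_pmf)
  have "measure_pmf.prob (coins (n + N * n)) {bs. ?all (Suc N) bs}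
     = measure_pmf.prob (pair_pmf (coins n) (coins (N * n))) ((\<lambda>(x, y). x @ y) -` {bs. ?all (Suc N) bs})"
    by (simp add: coins)
  also have "\<dots> = measure_pmf.prob (pair_pmf (coins n) (coins (N * n))) ({b. G b} \<times> {bs. ?all N bs})"
    by (rule measure_pmf.finite_measure_eq_AE) (auto simp: AE_measure_pmf_iff set_replicate_pmf)
  also have "\<dots> = measure_pmf.prob (coins n) {b. G b} * measure_pmf.prob (coins (N * n)) {bs. ?all N bs}"
    by (rule measure_pmf_prob_product) auto
  finally show ?case using Suc by simp
qed

section \<open>Random flips of an optimal assignment\<close>

definition flip :: "nat \<Rightarrow> bool list \<Rightarrow> nat set \<Rightarrow> bool list" where
  "flip n z D = map (\<lambda>i. z ! i \<noteq> (i \<in> D)) [0..<n]"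

lemma length_flip [simp]: "length (flip n z D) = n"
  by (simp add: flip_def)

lemma inj_on_flip: "inj_on (flip n z) (Pow {..<n})"
proof (rule inj_onI)
  fix D E assume DE: "D \<in> Pow {..<n}" "E \<in> Pow {..<n}" "flip n z D = flip n z E"
  have "i \<in> D \<longleftrightarrow> i \<in> E" if "i < n" for i
  proof -
    have "flip n z D ! i = flip n z E ! i" using DE(3) by simp
    then show ?thesis using that by (auto simp: flip_def)
  qed
  then show "D = E" using DE by auto
qed

text \<open>A clause satisfied by \<open>z\<close> can only be lost if one particular true literal is flipped.\<close>
lemma lost_clause_var:
  assumes "sat_clause z cl" "\<And>l. l \<in> set cl \<Longrightarrow> var l < n"
  obtains v where "v < n" "\<And>D. \<not> sat_clause (flip n z D) cl \<Longrightarrow> v \<in> D"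
proof -
  obtain l where l: "l \<in> set cl" "sat_literal z l" using assms(1) by (auto simp: sat_clause_def)
  have "var l \<in> D" if "\<not> sat_clause (flip n z D) cl" for D
  proof (rule ccontr)
    assume "var l \<notin> D"
    then have "sat_literal (flip n z D) l"
      using l(2) assms(2)[OF l(1)] by (cases l) (auto simp: flip_def)
    then show False using that l(1) by (auto simp: sat_clause_def)
  qed
  then show ?thesis using assms(2)[OF l(1)] by (intro that)
qed

text \<open>A fixed element lies in a fraction d / n of the d-element sets. Subtracting the sets
  that avoid \<open>v\<close> brings in n - 1 choose d rather than n - 1 choose d - 1, so d = 0
  needs no separate treatment.\<close>

lemma card_subsets_containing:
  assumes "v < n"
  shows "n * card {D. D \<subseteq> {..<n} \<and> card D = d \<and> v \<in> D} = d * (n choose d)"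
proof (cases "d \<le> n")
  case True
  let ?A = "{D. D \<subseteq> {..<n} \<and> card D = d}"
  have fin: "finite ?A" by (rule finite_subset[of _ "Pow {..<n}"]) auto
  have "card {D. D \<subseteq> {..<n} - {v} \<and> card D = d} = (n - 1) choose d"
    using assms by (subst n_subsets) auto
  moreover have "{D \<in> ?A. v \<notin> D} = {D. D \<subseteq> {..<n} - {v} \<and> card D = d}" by auto
  moreover have "card ?A = n choose d" by (subst n_subsets) auto
  moreover have "card ?A = card {D \<in> ?A. v \<in> D} + card {D \<in> ?A. v \<notin> D}"
    using fin by (subst card_Un_disjoint[symmetric]) (auto intro: arg_cong[of _ _ card])
  ultimately have "n choose d = card {D \<in> ?A. v \<in> D} + ((n - 1) choose d)" by simp
  then have "n * (n choose d) = n * card {D \<in> ?A. v \<in> D} + n * ((n - 1) choose d)"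
    by (metis add_mult_distrib2)
  also have "n * ((n - 1) choose d) = (n - d) * (n choose d)"
    by (rule binomial_absorb_comp[symmetric])
  finally have "n * (n choose d) = n * card {D \<in> ?A. v \<in> D} + (n - d) * (n choose d)" .
  moreover have "(n - d) * (n choose d) + d * (n choose d) = n * (n choose d)"
    using True by (simp flip: add_mult_distrib)
  ultimately have "n * card {D \<in> ?A. v \<in> D} = d * (n choose d)" by linarith
  moreover have "{D \<in> ?A. v \<in> D} = {D. D \<subseteq> {..<n} \<and> card D = d \<and> v \<in> D}" by auto
  ultimately show ?thesis by simp
next
  case False
  then have "{D. D \<subseteq> {..<n} \<and> card D = d \<and> v \<in> D} = {}"
    using card_mono[of "{..<n}"] by fastforce
  then show ?thesis using False by (simp only: card.empty binomial_eq_0 not_le) 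
qed

lemma num_sat_flip:
  "num_sat f z \<le> num_sat f (flip n z D) +
     length (filter (\<lambda>cl. sat_clause z cl \<and> \<not> sat_clause (flip n z D) cl) f)"
  by (induction f) (auto simp: num_sat_def)

lemma sum_length_filter:
  "finite S \<Longrightarrow> (\<Sum>D\<in>S. length (filter (P D) xs)) = (\<Sum>x\<leftarrow>xs. card {D \<in> S. P D x})"
proof (induction xs)
  case (Cons x xs)
  have "(\<Sum>D\<in>S. length (filter (P D) (x # xs))) = (\<Sum>D\<in>S. of_bool (P D x) + length (filter (P D) xs))"
    by (intro sum.cong) auto
  also have "\<dots> = card {D \<in> S. P D x} + (\<Sum>x\<leftarrow>xs. card {D \<in> S. P D x})"
    using Cons by (simp add: sum.distrib sum_of_bool_eq Int_def)
  finally show ?case by simp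
qed simp

lemma max_sat_attained:
  obtains z where "length z = n" "num_sat f z = max_sat n f"
proof -
  have fin: "finite {z :: bool list. length z = n}"
    using finite_lists_length_eq[of "UNIV :: bool set" n] by simp
  have "{z :: bool list. length z = n} \<noteq> {}"
    using Ex_list_of_length by auto
  then have "max_sat n f \<in> num_sat f ` {z. length z = n}"
    unfolding max_sat_def using fin by (intro Max_in) auto
  then show ?thesis using that by auto
qed

text \<open>Average the loss over all \<open>d\<close>-element sets of flipped variables and apply Markov.\<close>
lemma many_good_assignments:
  assumes vars: "\<And>cl l. cl \<in> set f \<Longrightarrow> l \<in> set cl \<Longrightarrow> var l < n"
    and \<delta>: "0 < \<delta>" "real d \<le> \<delta> * real n"
  shows "real (n choose d) / 2 \<le>
    real (card {z. length z = n \<and> (1 - 2 * \<delta>) * real (max_sat n f) \<le> real (num_sat f z)})"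
proof -
  obtain z where z: "length z = n" "num_sat f z = max_sat n f" by (rule max_sat_attained)
  define S where "S = {D. D \<subseteq> {..<n} \<and> card D = d}"
  define loss where "loss D = length (filter (\<lambda>cl. sat_clause z cl \<and> \<not> sat_clause (flip n z D) cl) f)" for D
  define bad where "bad = {D \<in> S. 2 * \<delta> * real (max_sat n f) < real (loss D)}"
  have fin: "finite S" unfolding S_def by (rule finite_subset[of _ "Pow {..<n}"]) auto
  have card_S: "card S = n choose d" unfolding S_def by (subst n_subsets) auto
  \<comment> \<open>Losing the clause forces its guarding variable into D, which happens for a
    fraction d / n \<le> \<delta> of the sets.\<close>
  have clause: "real (card {D \<in> S. sat_clause z cl \<and> \<not> sat_clause (flip n z D) cl})
      \<le> of_bool (sat_clause z cl) * (\<delta> * real (n choose d))" if "cl \<in> set f" for cl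
  proof (cases "sat_clause z cl")
    case True
    then obtain v where v: "v < n" "\<And>D. \<not> sat_clause (flip n z D) cl \<Longrightarrow> v \<in> D"
      using lost_clause_var vars \<open>cl \<in> set f\<close> by metis
    let ?B = "{D. D \<subseteq> {..<n} \<and> card D = d \<and> v \<in> D}"
    have "finite ?B" by (rule finite_subset[of _ "Pow {..<n}"]) auto
    then have "card {D \<in> S. sat_clause z cl \<and> \<not> sat_clause (flip n z D) cl} \<le> card ?B"
      using v(2) by (intro card_mono) (auto simp: S_def)
    moreover have "real n * real (card ?B) \<le> real n * (\<delta> * real (n choose d))"
      using card_subsets_containing[OF v(1), of d] mult_right_mono[OF \<delta>(2), of "real (n choose d)"]
      by (simp add: algebra_simps flip: of_nat_mult)
    ultimately show ?thesis using v(1) True by simp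
  qed simp
  have "real (card bad) * (2 * \<delta> * real (max_sat n f)) \<le> (\<Sum>D\<in>bad. real (loss D))"
    using sum_bounded_below[of bad "2 * \<delta> * real (max_sat n f)" "\<lambda>D. real (loss D)"]
    by (simp add: bad_def less_imp_le)
  also have "\<dots> \<le> (\<Sum>D\<in>S. real (loss D))"
    using fin by (intro sum_mono2) (auto simp: bad_def)
  also have "\<dots> = real (\<Sum>cl\<leftarrow>f. card {D \<in> S. sat_clause z cl \<and> \<not> sat_clause (flip n z D) cl})"
    using sum_length_filter[OF fin] by (simp add: loss_def flip: of_nat_sum)
  also have "\<dots> = (\<Sum>cl\<leftarrow>f. real (card {D \<in> S. sat_clause z cl \<and> \<not> sat_clause (flip n z D) cl}))"
    by (induction f) auto
  also have "\<dots> \<le> (\<Sum>cl\<leftarrow>f. of_bool (sat_clause z cl) * (\<delta> * real (n choose d)))"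
    using clause by (intro sum_list_mono) auto
  also have "\<dots> = real (max_sat n f) * (\<delta> * real (n choose d))"
    unfolding z(2)[symmetric] num_sat_def by (induction f) (auto simp: algebra_simps)
  finally have *: "real (max_sat n f) * (2 * \<delta> * real (card bad)) \<le> real (max_sat n f) * (\<delta> * real (n choose d))"
    by (simp add: algebra_simps)
  have bad: "real (card bad) \<le> real (n choose d) / 2"
  \<comment> \<open>Markov's inequality divides by the optimum. If the optimum is 0, no clause can
    be lost and there are no bad sets at all.\<close>
  proof (cases "max_sat n f = 0")
    case True
    have "loss D \<le> num_sat f z" for D
      unfolding loss_def num_sat_def by (induction f) auto
    then have "bad = {}" using True z(2) by (auto simp: bad_def)
    then show ?thesis by simp
  next
    case False
    then have "2 * \<delta> * real (card bad) \<le> \<delta> * real (n choose d)" using * by simp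
    then show ?thesis using \<delta>(1) by simp
  qed
  \<comment> \<open>Distinct sets of flipped variables give distinct assignments, so the good sets
    can be counted instead of the good assignments.\<close>
  have "flip n z ` (S - bad) \<subseteq> {z. length z = n \<and> (1 - 2 * \<delta>) * real (max_sat n f) \<le> real (num_sat f z)}"
  proof clarsimp
    fix D assume "D \<in> S" "D \<notin> bad"
    then have "real (loss D) \<le> 2 * \<delta> * real (max_sat n f)" by (auto simp: bad_def)
    moreover have "real (max_sat n f) \<le> real (num_sat f (flip n z D)) + real (loss D)"
      using num_sat_flip[of f z n D] z(2) by (simp add: loss_def flip: of_nat_add)
    ultimately show "(1 - 2 * \<delta>) * real (max_sat n f) \<le> real (num_sat f (flip n z D))"
      by (simp add: algebra_simps)
  qed
  moreover have "finite {z. length z = n \<and> (1 - 2 * \<delta>) * real (max_sat n f) \<le> real (num_sat f z)}"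
    by (rule finite_subset[of _ "{z :: bool list. length z = n}"])
       (use finite_lists_length_eq[of "UNIV :: bool set" n] in auto)
  ultimately have "card (flip n z ` (S - bad)) \<le>
     card {z. length z = n \<and> (1 - 2 * \<delta>) * real (max_sat n f) \<le> real (num_sat f z)}"
    by (rule card_mono[rotated])
  moreover have "card (flip n z ` (S - bad)) = card (S - bad)"
    by (rule card_image) (rule inj_on_subset[OF inj_on_flip], auto simp: S_def)
  moreover have "card (S - bad) = (n choose d) - card bad"
    using fin card_S by (subst card_Diff_subset) (auto simp: bad_def)
  ultimately show ?thesis using bad by linarith
qed

text \<open>For the floor d of \<delta> n, n choose d is at least (n / d)^d, hence at least (1 /
  \<delta>)^d because d \<le> \<delta> n. The leading factor \<delta> pays for d being smaller than
  \<delta> n by up to one.\<close>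

lemma choose_floor_ge:
  fixes \<delta> :: real
  assumes "0 < \<delta>" "\<delta> \<le> 1"
  shows "\<delta> * exp (\<delta> * ln (1 / \<delta>)) ^ n \<le> real (n choose nat \<lfloor>\<delta> * real n\<rfloor>)"
proof -
  define d where "d = nat \<lfloor>\<delta> * real n\<rfloor>"
  have d: "real d \<le> \<delta> * real n" "\<delta> * real n \<le> real d + 1"
    using assms unfolding d_def by simp_all
  have "\<delta> * real n \<le> 1 * real n" using assms by (intro mult_right_mono) auto
  then have dn: "d \<le> n" using d(1) by simp
  have "\<delta> * exp (\<delta> * ln (1 / \<delta>)) ^ n = exp ((\<delta> * real n - 1) * ln (1 / \<delta>))"
  proof -
    have "exp (\<delta> * ln (1 / \<delta>)) ^ n = exp (real n * (\<delta> * ln (1 / \<delta>)))"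
      by (rule exp_of_nat_mult[symmetric])
    moreover have "\<delta> = exp (- ln (1 / \<delta>))" using assms by (simp add: ln_div)
    ultimately have "\<delta> * exp (\<delta> * ln (1 / \<delta>)) ^ n =
        exp (- ln (1 / \<delta>) + real n * (\<delta> * ln (1 / \<delta>)))"
      by (simp only: exp_add)
    also have "- ln (1 / \<delta>) + real n * (\<delta> * ln (1 / \<delta>)) = (\<delta> * real n - 1) * ln (1 / \<delta>)"
      by (simp add: algebra_simps)
    finally show ?thesis .
  qed
  also have "\<dots> \<le> exp (real d * ln (1 / \<delta>))"
    using assms d(2) by (intro exp_le_cancel_iff[THEN iffD2] mult_right_mono) auto
  also have "\<dots> = (1 / \<delta>) ^ d"
    using assms by (simp add: exp_of_nat_mult)
  also have "\<dots> \<le> (real n / real d) ^ d"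
  \<comment> \<open>For d = 0 the quotient n / d is 0 by convention, but both powers are 1.\<close>
  proof (cases "d = 0")
    case False
    then show ?thesis using d(1) assms by (intro power_mono) (auto simp: field_simps)
  qed simp
  also have "\<dots> \<le> real (n choose d)"
    using binomial_ge_n_over_k_pow_k[OF dn, where 'a = real] by simp
  finally show ?thesis unfolding d_def .
qed

section \<open>Running time and success probability\<close>

lemma length_enc_le:
  assumes "ksat_instance k n f"
  shows "length (enc_instance n f) \<le> 2 + length f * (k + 1)"
proof -
  have "length (concat (map (\<lambda>cl. length cl # map enc_literal cl) f)) \<le> length f * (k + 1)"
    using assms unfolding ksat_instance_def by (induction f) auto
  then show ?thesis by (simp add: enc_instance_def)
qed

lemma enc_instance_less:
  assumes "ksat_instance k n f" "x \<in> set (enc_instance n f)"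
  shows "x < 2 * n + length (enc_instance n f)"
proof -
  have "length cl \<le> length (concat (map (\<lambda>cl. length cl # map enc_literal cl) f))" if "cl \<in> set f" for cl
    using that by (induction f) auto
  moreover have "length f \<le> length (concat (map (\<lambda>cl. length cl # map enc_literal cl) f))"
    by (induction f) auto
  moreover have "enc_literal l < 2 * n" if "cl \<in> set f" "l \<in> set cl" for cl l
    using assms(1) that by (cases l) (fastforce simp: ksat_instance_def)+
  ultimately show ?thesis using assms(2) by (fastforce simp: enc_instance_def)
qed

text \<open>From x < 2^x one gets P^n \<le> 2^(P n) and similar bounds for all numbers in
  \<open>search_ram\<close>; the word size dominates all the exponents. For fixed P, Q and C it is
  linear in n plus the input length, which is what polynomial space requires.\<close>

definition word_size :: "nat \<Rightarrow> nat \<Rightarrow> nat \<Rightarrow> nat \<Rightarrow> formula \<Rightarrow> nat" where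
  "word_size P Q C n f = length (enc_instance n f) + P + Q + C + 5 + (P + Q + 4) * n"

lemma search_ram_word_size:
  assumes inst: "ksat_instance k n f" and PQ: "0 < P" "0 < Q"
  shows "search_ram (2 ^ word_size P Q C n f) (n + length (enc_instance n f)) n f P Q C"
proof
  let ?W = "word_size P Q C n f"
  have less: "x < 2 ^ x" for x :: nat by (rule less_exp)
  have n: "n + 1 \<le> 2 ^ n" using Suc_leI[OF less[of n]] by (simp only: Suc_eq_plus1)
  have pow: "x ^ n \<le> 2 ^ (x * n)" for x :: nat
    unfolding power_mult using less[of x] by (intro power_mono) auto
  have mono: "2 ^ i \<le> (2 :: nat) ^ ?W" if "i \<le> ?W" for i
    using that by (intro power_increasing) auto
  let ?y = "2 * n + length (enc_instance n f) + P + Q + C + 4"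
  have "2 ^ n \<le> (2 :: nat) ^ (n + ?y)" "(2 :: nat) ^ ?y \<le> 2 ^ (n + ?y)"
    by (intro power_increasing; simp)+
  then have "2 ^ n + ?y \<le> 2 ^ Suc (n + ?y)"
    using less[of ?y] unfolding power_Suc by linarith
  also have "\<dots> \<le> 2 ^ ?W" by (rule mono) (simp add: word_size_def algebra_simps)
  finally show "2 ^ n + 2 * n + length (enc_instance n f) + P + Q + C + 4 \<le> 2 ^ ?W"
    by (simp only: add.assoc)
  have 1: "P ^ n + 1 \<le> 2 ^ Suc (P * n)"
    using pow[of P] one_le_power[of "2 :: nat" "P * n"] unfolding power_Suc by linarith
  also have "\<dots> < 2 ^ ?W"
    by (rule power_strict_increasing) (auto simp: word_size_def algebra_simps)
  finally show "P ^ n + 1 < 2 ^ ?W" .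
  have "Q ^ n \<le> 2 ^ (Q * n)" by (rule pow)
  also have "\<dots> < 2 ^ ?W"
    by (rule power_strict_increasing) (auto simp: word_size_def algebra_simps)
  finally show "Q ^ n < 2 ^ ?W" .
  have "C * (n + 1) * (P ^ n + 1) \<le> 2 ^ C * 2 ^ n * 2 ^ Suc (P * n)"
    by (intro mult_le_mono less_imp_le[OF less[of C]] n 1)
  also have "\<dots> = 2 ^ (C + n + Suc (P * n))" by (simp only: power_add)
  also have "\<dots> < 2 ^ ?W"
    by (rule power_strict_increasing) (auto simp: word_size_def algebra_simps)
  finally show "C * (n + 1) * (P ^ n + 1) < 2 ^ ?W" .
qed (use inst PQ in \<open>auto simp: ksat_instance_def\<close>)

lemma prob_rev_coins:
  "measure_pmf.prob (coins n) {b. G (rev b)} = card {z. length z = n \<and> G z} / 2 ^ n"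
proof -
  have "bij_betw rev {b. length b = n \<and> G (rev b)} {z. length z = n \<and> G z}"
    by (rule bij_betwI[of _ _ _ rev]) auto
  then show ?thesis by (simp add: prob_coins bij_betw_same_card)
qed

definition num_samples :: "nat \<Rightarrow> nat \<Rightarrow> nat \<Rightarrow> nat \<Rightarrow> nat" where
  "num_samples P Q C n = C * (n + 1) * (P ^ n div Q ^ n + 1)"

definition round_bound :: "nat \<Rightarrow> nat \<Rightarrow> formula \<Rightarrow> nat" where
  "round_bound k n f = length f * (k * (3 * n + 13) + 8) + 5 * n + 15"

text \<open>The output satisfies at least as many clauses as every sample, so for upward closed
  \<open>G\<close> one good sample suffices. Failure then means N independent bad samples.\<close>

lemma search_prog_runs:
  fixes G :: "bool list \<Rightarrow> bool" and C :: nat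
  assumes inst: "ksat_instance k n f" and PQ: "0 < P" "0 < Q"
    and G: "\<And>z z'. G z \<Longrightarrow> num_sat f z \<le> num_sat f z' \<Longrightarrow> G z'"
  defines "W \<equiv> word_size P Q C n f" and "N \<equiv> num_samples P Q C n"
  shows "runs_within (search_prog P Q C) (enc_instance n f)
      (real ((N * (round_bound k n f + 1) + 12 * n + 20) * (1 + 2 * W)))
      (real (20 * W + (n + length (enc_instance n f)) * (2 * W)))"
    and "success_prob (search_prog P Q C) (enc_instance n f) (\<lambda>\<mu>. G (out_assignment n \<mu>))
      \<ge> 1 - (1 - card {z. length z = n \<and> G z} / 2 ^ n) ^ N"
proof -
  let ?xs = "enc_instance n f"
  interpret search_ram "2 ^ W" "n + length ?xs" n f P Q C
    unfolding W_def by (rule search_ram_word_size[OF inst PQ])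
  let ?\<mu> = "\<lambda>a. if a < length ?xs then ?xs ! a else 0"
  let ?H = "\<lambda>bs. \<exists>b\<in>set (blocks n N bs). G (rev b)"
  have stored: "stored ?\<mu> 0 ?xs" by (simp add: stored_iff)
  have "(\<Sum>cl\<leftarrow>f. length cl * (3 * n + 13) + 8) \<le> (\<Sum>cl\<leftarrow>f. k * (3 * n + 13) + 8)"
    using inst by (intro sum_list_mono add_mono mult_le_mono) (auto simp: ksat_instance_def)
  then have round: "round_time \<le> round_bound k n f"
    by (simp add: round_time_def round_bound_def sum_list_triv)
  have comp: "computes (\<lambda>_ \<mu>. ?H bs \<longrightarrow> G (out_assignment n \<mu>)) (search_prog P Q C) (\<lambda>_. 0) ?\<mu> bs
      (N * (round_bound k n f + 1) + 12 * n + 20)" if "length bs = N * n" for bs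
  proof (rule computes_mono[OF computes_weaken[OF computes_search_prog]])
    show "C * (n + 1) * (P ^ n div Q ^ n + 1) * (round_time + 1) + 12 * n + 20
       \<le> N * (round_bound k n f + 1) + 12 * n + 20"
      using round unfolding N_def num_samples_def by (intro add_mono mult_le_mono) auto
  qed (use stored that G in \<open>auto simp: N_def num_samples_def\<close>)
  have small: "x < 2 ^ W" if "x \<in> set ?xs" for x
    using enc_instance_less[OF inst that] room by simp
  have room': "n + length ?xs \<le> 2 ^ W" "2 \<le> (2::nat) ^ W" using room by simp_all
  note runs = computes_imp_runs[OF comp _ small refl room']
  show "runs_within (search_prog P Q C) ?xs
      (real ((N * (round_bound k n f + 1) + 12 * n + 20) * (1 + 2 * W)))
      (real (20 * W + (n + length ?xs) * (2 * W)))"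
    by (rule runs(1)) auto
  have "1 - (1 - card {z. length z = n \<and> G z} / 2 ^ n) ^ N = 
      1 - (1 - measure_pmf.prob (coins n) {b. G (rev b)}) ^ N"
    by (simp add: prob_rev_coins)
  also have "1 - measure_pmf.prob (coins n) {b. G (rev b)} = measure_pmf.prob (coins n) {b. \<not> G (rev b)}"
    using measure_pmf.prob_compl[of "{b. G (rev b)}" "coins n"] by (simp add: Collect_neg_eq Compl_eq_Diff_UNIV)
  also have "measure_pmf.prob (coins n) {b. \<not> G (rev b)} ^ N =
      measure_pmf.prob (coins (N * n)) {bs. \<not> ?H bs}"
    by (simp add: prob_all_blocks[symmetric])
  also have "1 - \<dots> = measure_pmf.prob (coins (N * n)) {bs. ?H bs}"
  proof -
    have "{bs. ?H bs} = UNIV - {bs. \<not> ?H bs}" by auto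
    then show ?thesis
      using measure_pmf.prob_compl[of "{bs. \<not> ?H bs}" "coins (N * n)"] by simp
  qed
  also have "\<dots> \<le> success_prob (search_prog P Q C) ?xs (\<lambda>\<mu>. G (out_assignment n \<mu>))"
    by (rule runs(2)) auto
  finally show "success_prob (search_prog P Q C) ?xs (\<lambda>\<mu>. G (out_assignment n \<mu>))
      \<ge> 1 - (1 - card {z. length z = n \<and> G z} / 2 ^ n) ^ N" .
qed

lemma runs_within_mono:
  "runs_within M xs T S \<Longrightarrow> T \<le> T' \<Longrightarrow> S \<le> S' \<Longrightarrow> runs_within M xs T' S'"
  unfolding runs_within_def by (meson order_trans)

text \<open>Without repeated clauses the number of clauses is polynomial in n, which turns bounds in
  n + m into bounds in n alone. The added 1 keeps the base positive, so that lower powers are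
  dominated by the k-th.\<close>

lemma length_distinct_ksat:
  assumes "ksat_instance k n f" "distinct f"
  shows "length f \<le> (k + 1) * (2 * n + 1) ^ k"
proof -
  let ?L = "Pos ` {..<n} \<union> Neg ` {..<n}"
  have sub: "set f \<subseteq> {cl. set cl \<subseteq> ?L \<and> length cl \<le> k}"
  proof clarify
    fix cl l assume cl: "cl \<in> set f"
    show "set cl \<subseteq> ?L \<and> length cl \<le> k"
    proof
      show "set cl \<subseteq> ?L"
      proof
        fix l assume "l \<in> set cl"
        then have "var l < n" using cl assms(1) by (auto simp: ksat_instance_def)
        then show "l \<in> ?L" by (cases l) auto
      qed
    qed (use cl assms(1) in \<open>auto simp: ksat_instance_def\<close>)
  qed
  have L: "card ?L \<le> 2 * n"
    using card_Un_le[of "Pos ` {..<n}" "Neg ` {..<n}"] card_image_le[of "{..<n}" Pos] card_image_le[of "{..<n}" Neg]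
    by simp
  have "length f = card (set f)" using assms(2) by (simp add: distinct_card)
  also have "\<dots> \<le> card {cl. set cl \<subseteq> ?L \<and> length cl \<le> k}"
    by (rule card_mono[OF _ sub]) (rule finite_lists_length_le, simp)
  also have "\<dots> = (\<Sum>i\<le>k. card ?L ^ i)" by (rule card_lists_length_le) simp
  also have "\<dots> \<le> (\<Sum>i\<le>k. (2 * n + 1) ^ k)"
  proof (rule sum_mono)
    fix i assume "i \<in> {..k}"
    have "card ?L ^ i \<le> (2 * n + 1) ^ i" using L by (intro power_mono) auto
    also have "\<dots> \<le> (2 * n + 1) ^ k" using \<open>i \<in> {..k}\<close> by (intro power_increasing) auto
    finally show "card ?L ^ i \<le> (2 * n + 1) ^ k" .
  qed
  finally show ?thesis by simp
qed

definition cost_const :: "nat \<Rightarrow> nat \<Rightarrow> nat \<Rightarrow> nat \<Rightarrow> nat" where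
  "cost_const k P Q C = k + 2 * P + 2 * Q + C + 12"

text \<open>The exponent 4 of s splits into one for the factor n + 1 of the number of samples, two
  for a round and one for the cost of an instruction. The space bound is quadratic: linearly many
  cells of linear word size.\<close>

lemma search_costs:
  fixes k n P Q C :: nat and f :: formula
  assumes inst: "ksat_instance k n f" and PQ: "Q \<le> P" "0 < Q"
  defines "s \<equiv> 1 + real (n + length f)" and "\<rho> \<equiv> real P / real Q" and "c \<equiv> cost_const k P Q C"
    and "W \<equiv> word_size P Q C n f"
  shows "real ((num_samples P Q C n * (round_bound k n f + 1) + 12 * n + 20) * (1 + 2 * W))
           \<le> real ((2 * C * (13 * k + 24) + 20) * (1 + 2 * c)) * s ^ 4 * \<rho> ^ n" (is ?time)
    and "real (20 * W + (n + length (enc_instance n f)) * (2 * W))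
           \<le> real ((20 + 2 * (k + 3)) * c) * s ^ 2" (is ?space)
proof -
  let ?m = "length f" and ?L = "length (enc_instance n f)"
  define S where "S = 1 + n + ?m"
  have s: "s = real S" by (simp add: s_def S_def)
  have S: "n \<le> S" "?m \<le> S" "1 \<le> S" by (simp_all add: S_def)
  have L: "?L \<le> 2 * S + S * (k + 1)"
    using length_enc_le[OF inst] mult_le_mono1[OF S(2), of "k + 1"] S(3) by linarith
  have "W \<le> (2 * S + S * (k + 1)) + (P + Q + C + 5) * S + (P + Q + 4) * S"
  proof -
    have "W = ?L + (P + Q + C + 5) * 1 + (P + Q + 4) * n" by (simp add: W_def word_size_def)
    then show ?thesis using L S by (simp only:) (intro add_mono mult_le_mono; simp)
  qed
  then have W: "W \<le> c * S" by (simp add: c_def cost_const_def algebra_simps)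
  then have W1: "1 + 2 * W \<le> (1 + 2 * c) * S" using S(3) by (simp add: algebra_simps)
  have "n + ?L \<le> (k + 3) * S"
    using length_enc_le[OF inst] mult_le_mono1[OF S(2), of "k + 1"] unfolding S_def by (simp add: algebra_simps)
  moreover have "W \<le> c * S * S" by (rule le_trans[OF W]) (use S(3) in simp)
  ultimately have "20 * W + (n + ?L) * (2 * W) \<le> 20 * (c * S * S) + ((k + 3) * S) * (2 * (c * S))"
    using W by (intro add_mono mult_le_mono) auto
  then have "real (20 * W + (n + ?L) * (2 * W)) \<le> real (20 * (c * S * S) + ((k + 3) * S) * (2 * (c * S)))"
    by (rule of_nat_mono)
  then show ?space by (simp add: s power2_eq_square algebra_simps)
  have "3 * n + 13 \<le> 13 * S" by (simp add: S_def)
  then have "k * (3 * n + 13) + 8 \<le> k * (13 * S) + 8 * S" using S(3) by (intro add_mono mult_le_mono) auto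
  then have "?m * (k * (3 * n + 13) + 8) \<le> S * (k * (13 * S) + 8 * S)" using S(2) by (rule mult_le_mono[rotated])
  moreover have "5 * n + 16 \<le> 16 * S" by (simp add: S_def)
  then have "5 * n + 16 \<le> 16 * (S * S)" by (rule le_trans) (use S(3) in simp)
  ultimately have rb: "round_bound k n f + 1 \<le> (13 * k + 24) * S ^ 2"
    unfolding round_bound_def by (simp add: power2_eq_square algebra_simps)
  have \<rho>: "1 \<le> \<rho>" using PQ by (simp add: \<rho>_def)
  then have \<rho>n: "1 \<le> \<rho> ^ n" by simp
  have "real (P ^ n div Q ^ n) \<le> \<rho> ^ n"
  proof -
    have "real (P ^ n div Q ^ n * Q ^ n) \<le> real (P ^ n)" by (intro of_nat_mono) simp
    then show ?thesis using PQ(2) by (simp add: \<rho>_def power_divide le_divide_eq)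
  qed
  \<comment> \<open>Since \<rho> \<ge> 1, the one added to the rounded power is at most
    \<rho>^n.\<close>
  then have "real C * real (n + 1) * (real (P ^ n div Q ^ n) + 1) \<le> real C * s * (2 * \<rho> ^ n)"
    using \<rho>n by (intro mult_mono) (auto simp: s_def)
  then have N: "real (num_samples P Q C n) \<le> real C * s * (2 * \<rho> ^ n)"
    by (simp add: num_samples_def algebra_simps)
  have s1: "1 \<le> s" "0 \<le> s" by (simp_all add: s_def)
  have "12 * real n + 20 \<le> 20 * s" by (simp add: s_def)
  also have "\<dots> \<le> 20 * (s ^ 3 * \<rho> ^ n)"
    using s1 \<rho>n mult_mono[of s "s ^ 3" 1 "\<rho> ^ n"] power_increasing[of 1 3 s] by simp
  finally have rest: "12 * real n + 20 \<le> 20 * (s ^ 3 * \<rho> ^ n)" .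
  have "real (round_bound k n f + 1) \<le> real ((13 * k + 24) * S ^ 2)" using rb by (rule of_nat_mono)
  then have "real (num_samples P Q C n) * real (round_bound k n f + 1)
      \<le> (real C * s * (2 * \<rho> ^ n)) * (real (13 * k + 24) * s ^ 2)"
    using N s1 \<rho>n by (intro mult_mono) (auto simp: s)
  also have "\<dots> = real (2 * C * (13 * k + 24)) * (s ^ 3 * \<rho> ^ n)"
    by (simp add: power2_eq_square power3_eq_cube algebra_simps)
  finally have "real (num_samples P Q C n * (round_bound k n f + 1) + 12 * n + 20)
      \<le> real (2 * C * (13 * k + 24)) * (s ^ 3 * \<rho> ^ n) + 20 * (s ^ 3 * \<rho> ^ n)"
    using rest by (simp add: ring_distribs)
  also have "\<dots> = real (2 * C * (13 * k + 24) + 20) * (s ^ 3 * \<rho> ^ n)"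
    by (simp add: algebra_simps)
  finally have t: "real (num_samples P Q C n * (round_bound k n f + 1) + 12 * n + 20)
      \<le> real (2 * C * (13 * k + 24) + 20) * (s ^ 3 * \<rho> ^ n)" .
  have "real (1 + 2 * W) \<le> real (1 + 2 * c) * s"
    using of_nat_mono[OF W1, where 'a = real] by (simp only: s of_nat_mult)
  with t have "real (num_samples P Q C n * (round_bound k n f + 1) + 12 * n + 20) * real (1 + 2 * W)
      \<le> (real (2 * C * (13 * k + 24) + 20) * (s ^ 3 * \<rho> ^ n)) * (real (1 + 2 * c) * s)"
    using s1 \<rho>n by (intro mult_mono) auto
  also have "\<dots> = real ((2 * C * (13 * k + 24) + 20) * (1 + 2 * c)) * s ^ 4 * \<rho> ^ n"
    unfolding of_nat_mult by (simp only: power3_eq_cube power4_eq_xxxx mult.assoc mult.left_commute mult.commute)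
  finally show ?time unfolding of_nat_mult .
qed

section \<open>Inequalities for the base and the failure probability\<close>

lemma gain_le:
  fixes \<epsilon> :: real
  assumes "1 \<le> k" "0 < \<epsilon>" "\<epsilon> \<le> 1"
  shows "\<epsilon> / real k * ln (real k / \<epsilon>) \<le> 2 * (\<epsilon> / 2 * ln (1 / (\<epsilon> / 2)))"
proof -
  \<comment> \<open>Split ln (k / \<epsilon>) into ln k + ln (1 / \<epsilon>). Because ln k \<le> k
    ln 2, the division by k leaves at most \<epsilon> ln 2 from the first term, and it can only
    decrease the second. The sum \<epsilon> ln 2 + \<epsilon> ln (1 / \<epsilon>) is the right-hand
    side.\<close>
  have "real k \<le> 2 ^ k" using less_exp[of k] by (simp add: of_nat_less_numeral_power_cancel_iff less_imp_le)
  then have "ln (real k) \<le> ln (2 ^ k)" using assms by (subst ln_le_cancel_iff) auto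
  then have "ln (real k) \<le> real k * ln 2" by (simp add: ln_realpow)
  then have 1: "\<epsilon> / real k * ln (real k) \<le> \<epsilon> * ln 2"
    using assms by (simp add: field_simps)
  have "0 \<le> ln (1 / \<epsilon>)" using assms by simp
  then have "\<epsilon> * ln (1 / \<epsilon>) \<le> real k * (\<epsilon> * ln (1 / \<epsilon>))"
    using assms mult_right_mono[of 1 "real k" "\<epsilon> * ln (1 / \<epsilon>)"] by simp
  then have "\<epsilon> / real k * ln (1 / \<epsilon>) \<le> \<epsilon> * ln (1 / \<epsilon>)"
    using assms by (simp add: divide_le_eq mult.commute)
  with 1 show ?thesis
    using assms by (simp add: ln_div algebra_simps)
qed

lemma mult_ln_inverse_le_1: "0 < x \<Longrightarrow> x \<le> 1 \<Longrightarrow> x * ln (1 / x) \<le> (1 :: real)"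
proof -
  assume "0 < x" "x \<le> 1"
  then have "x * ln (1 / x) \<le> x * (1 / x - 1)" by (intro mult_left_mono ln_le_minus_one) auto
  also have "\<dots> \<le> 1" using \<open>0 < x\<close> by (simp add: algebra_simps)
  finally show ?thesis .
qed

lemma exp_gain:
  fixes x \<rho> :: real
  assumes "0 \<le> x" "x \<le> 1" "2 - x \<le> \<rho>"
  shows "2 \<le> \<rho> * exp x"
proof -
  have "x * x \<le> x" using assms mult_left_mono[of x 1 x] by simp
  then have "2 \<le> (2 - x) * (1 + x)" by (simp add: algebra_simps)
  also have "\<dots> \<le> \<rho> * exp x"
    using assms by (intro mult_mono) (auto simp: add.commute)
  finally show ?thesis .
qed

text \<open>It suffices that p N \<ge> a ln (n + 1), as (1 - p)^N \<le> exp (- p N). In the product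
  p N the constant C cancels \<delta> / 2 and contributes a, the factor n + 1 dominates the
  logarithm, and the exponential part is at least 1 by \<open>gain\<close>.\<close>

lemma num_samples_enough:
  fixes p \<delta> x :: real and P Q C n a :: nat
  assumes "0 < Q" "0 < \<delta>" and C: "2 * real a / \<delta> \<le> real C"
    and gain: "2 \<le> real P / real Q * exp x"
    and p: "\<delta> * exp x ^ n / 2 \<le> p * 2 ^ n" "p \<le> 1"
  shows "(1 - p) ^ num_samples P Q C n \<le> 1 / (real n + 1) ^ a"
proof -
  let ?N = "num_samples P Q C n" and ?\<rho> = "real P / real Q"
  have "\<delta> / 2 * exp x ^ n / 2 ^ n \<le> p" using p(1) by (simp add: field_simps)
  moreover have "0 \<le> \<delta> / 2 * exp x ^ n / 2 ^ n" using assms by simp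
  moreover have "?\<rho> ^ n \<le> real (P ^ n div Q ^ n) + 1"
  proof -
    have "P ^ n \<le> (P ^ n div Q ^ n + 1) * Q ^ n"
      using dividend_less_div_times[of "Q ^ n" "P ^ n"] assms(1) by simp
    then have "real (P ^ n) \<le> real ((P ^ n div Q ^ n + 1) * Q ^ n)" by (rule of_nat_mono)
    then show ?thesis using assms(1) by (simp add: power_divide divide_le_eq algebra_simps)
  qed
  then have "real C * (real n + 1) * ?\<rho> ^ n \<le> real C * (real n + 1) * (real (P ^ n div Q ^ n) + 1)"
    by (intro mult_left_mono) auto
  then have "real C * (real n + 1) * ?\<rho> ^ n \<le> real ?N"
    by (simp only: num_samples_def of_nat_mult of_nat_add of_nat_1)
  ultimately have "(\<delta> / 2 * exp x ^ n / 2 ^ n) * (real C * (real n + 1) * ?\<rho> ^ n) \<le> p * real ?N"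
    by (intro mult_mono) auto
  also have "(\<delta> / 2 * exp x ^ n / 2 ^ n) * (real C * (real n + 1) * ?\<rho> ^ n)
      = (\<delta> / 2 * real C) * (real n + 1) * ((?\<rho> * exp x) / 2) ^ n"
    by (simp add: power_mult_distrib power_divide mult_ac)
  finally have 1: "(\<delta> / 2 * real C) * (real n + 1) * ((?\<rho> * exp x) / 2) ^ n \<le> p * real ?N" .
  have "real a \<le> \<delta> / 2 * real C" using C assms(2) by (simp add: field_simps)
  moreover have "ln (real n + 1) \<le> real n + 1" using ln_le_minus_one[of "real n + 1"] by simp
  moreover have "1 \<le> ((?\<rho> * exp x) / 2) ^ n" using gain
    by (intro one_le_power) (simp only: le_divide_eq_numeral1 mult_1)
  ultimately have "real a * ln (real n + 1) * 1 \<le> (\<delta> / 2 * real C) * (real n + 1) * ((?\<rho> * exp x) / 2) ^ n"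
    using assms(2) by (intro mult_mono) auto
  with 1 have 2: "real a * ln (real n + 1) \<le> p * real ?N" by simp
  have "(1 - p) ^ ?N \<le> exp (- p) ^ ?N"
    using p(2) exp_ge_add_one_self[of "- p"] by (intro power_mono) auto
  also have "\<dots> = exp (- (p * real ?N))" by (simp add: exp_of_nat_mult[symmetric] mult.commute)
  also have "\<dots> \<le> exp (- (real a * ln (real n + 1)))" using 2 by simp
  also have "\<dots> = 1 / (real n + 1) ^ a" by (simp add: exp_minus exp_of_nat_mult inverse_eq_divide)
  finally show ?thesis .
qed

theorem theorem1:
  shows "\<exists>c::real. c > 0 \<and>
    (\<forall>(k::nat) (\<epsilon>::real) (a::nat). 1 \<le> k \<and> 0 < \<epsilon> \<and> \<epsilon> \<le> 1 \<longrightarrow>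
      (\<exists>M::program.
        (\<forall>n f. ksat_instance k n f \<longrightarrow>
          success_prob M (enc_instance n f)
            (\<lambda>\<mu>. real (num_sat f (out_assignment n \<mu>)) \<ge> (1 - \<epsilon>) * real (max_sat n f))
          \<ge> 1 - 1 / (real n + 1) ^ a) \<and>
        (\<exists>p q :: real poly. \<forall>n f. ksat_instance k n f \<longrightarrow>
          runs_within M (enc_instance n f)
            (poly p (real (n + length f)) * (2 - c * (\<epsilon> / real k * ln (real k / \<epsilon>))) ^ n)
            (poly q (real (n + length f)))) \<and>
        (\<exists>p q :: real poly. \<forall>n f. ksat_instance k n f \<and> distinct f \<longrightarrow>
          runs_within M (enc_instance n f)
            (poly p (real n) * (2 - c * (\<epsilon> / real k * ln (real k / \<epsilon>))) ^ n)
            (poly q (real n)))))"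
proof (intro exI[of _ "1 / 4"] conjI allI impI)
  fix k a :: nat and \<epsilon> :: real
  assume "1 \<le> k \<and> 0 < \<epsilon> \<and> \<epsilon> \<le> 1"
  then have k: "1 \<le> k" and \<epsilon>: "0 < \<epsilon>" "\<epsilon> \<le> 1" by auto
  define y where "y = \<epsilon> / real k * ln (real k / \<epsilon>)"
  define \<delta> where "\<delta> = \<epsilon> / 2"
  define x where "x = \<delta> * ln (1 / \<delta>)"
  have \<delta>: "0 < \<delta>" "\<delta> \<le> 1 / 2" using \<epsilon> by (simp_all add: \<delta>_def)
  have x: "0 < x" "x \<le> 1" using \<delta> mult_ln_inverse_le_1[of \<delta>] by (simp_all add: x_def)
  have "\<epsilon> / real k \<le> 1" using k \<epsilon> by (simp add: divide_le_eq)
  then have y: "y \<le> 1" using mult_ln_inverse_le_1[of "\<epsilon> / real k"] k \<epsilon> by (simp add: y_def)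
  have yx: "y \<le> 2 * x" unfolding y_def x_def \<delta>_def by (rule gain_le[OF k \<epsilon>])
  \<comment> \<open>From \<open>y \<le> 2 * x\<close> and x > 0, the factor 1 / 4 yields y / 4 \<le>
    x / 2 < x; a factor 1 / 2 would leave no strict gap for a rational number. The lower bound 1
    makes r > 1, hence Q \<le> P.\<close>
  have "max 1 (2 - x) < 2 - 1 / 4 * y" using x y yx by auto
  then obtain r where r: "r \<in> \<rat>" "max 1 (2 - x) < r" "r < 2 - 1 / 4 * y"
    using Rats_dense_in_real by blast
  obtain P Q :: nat where Q: "Q \<noteq> 0" "\<bar>r\<bar> = real P / real Q"
    using Rats_abs_nat_div_natE[OF r(1)] by metis
  with r have PQ: "real P / real Q = r" "0 < Q" by auto
  then have QP: "Q \<le> P" using r(2) by (simp add: field_simps flip: PQ(1))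
  obtain C :: nat where C: "2 * real a / \<delta> \<le> real C" using real_arch_simple by blast
  define cT where "cT = real ((2 * C * (13 * k + 24) + 20) * (1 + 2 * cost_const k P Q C))"
  define cS where "cS = real ((20 + 2 * (k + 3)) * cost_const k P Q C)"
  let ?M = "search_prog P Q C"
  let ?base = "2 - 1 / 4 * (\<epsilon> / real k * ln (real k / \<epsilon>))"
  have success: "1 - 1 / (real n + 1) ^ a \<le> success_prob ?M (enc_instance n f)
      (\<lambda>\<mu>. (1 - \<epsilon>) * real (max_sat n f) \<le> real (num_sat f (out_assignment n \<mu>)))"
    if inst: "ksat_instance k n f" for n f
  proof -
    let ?G = "\<lambda>z. (1 - \<epsilon>) * real (max_sat n f) \<le> real (num_sat f z)"
    let ?good = "{z. length z = n \<and> ?G z}"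
    let ?d = "nat \<lfloor>\<delta> * real n\<rfloor>"
    have "real ?d \<le> \<delta> * real n" using \<delta>(1) by simp
    then have "real (n choose ?d) / 2 \<le> real (card ?good)"
      using many_good_assignments[of f n \<delta> ?d] inst \<delta>(1) by (auto simp: ksat_instance_def \<delta>_def)
    moreover have "\<delta> * exp x ^ n \<le> real (n choose ?d)"
      unfolding x_def using \<delta> by (intro choose_floor_ge) auto
    ultimately have p: "\<delta> * exp x ^ n / 2 \<le> real (card ?good) / 2 ^ n * 2 ^ n" by simp
    have "real (card ?good) / 2 ^ n \<le> 1"
      unfolding prob_rev_coins[symmetric] by (rule measure_pmf.prob_le_1)
    with p have "(1 - real (card ?good) / 2 ^ n) ^ num_samples P Q C n \<le> 1 / (real n + 1) ^ a"
      using exp_gain[of x r] x r(2) PQ C \<delta>(1) by (intro num_samples_enough[of Q \<delta> a C P x]) auto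
    moreover have "1 - (1 - real (card ?good) / 2 ^ n) ^ num_samples P Q C n
        \<le> success_prob ?M (enc_instance n f) (\<lambda>\<mu>. ?G (out_assignment n \<mu>))"
      using inst PQ(2) QP by (intro search_prog_runs(2)) auto
    ultimately show ?thesis by linarith
  qed
  have runs: "runs_within ?M (enc_instance n f) (cT * (1 + real (n + length f)) ^ 4 * ?base ^ n)
      (cS * (1 + real (n + length f)) ^ 2)"
    if inst: "ksat_instance k n f" for n f
  \<comment> \<open>The resource bounds do not depend on the property of the output, so the trivial
    one is taken.\<close>
  proof (rule runs_within_mono[OF search_prog_runs(1)[OF inst, where G = "\<lambda>_. True"]])
    let ?s = "1 + real (n + length f)"
    have "r ^ n \<le> ?base ^ n" using r by (intro power_mono) (auto simp: y_def)
    then have "cT * ?s ^ 4 * r ^ n \<le> cT * ?s ^ 4 * ?base ^ n"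
      by (intro mult_left_mono) (auto simp: cT_def)
    then show "real ((num_samples P Q C n * (round_bound k n f + 1) + 12 * n + 20) * (1 + 2 * word_size P Q C n f))
        \<le> cT * ?s ^ 4 * ?base ^ n"
      using search_costs(1)[OF inst QP PQ(2), of C] unfolding cT_def PQ(1) by (rule order_trans[rotated])
    show "real (20 * word_size P Q C n f + (n + length (enc_instance n f)) * (2 * word_size P Q C n f)) \<le> cS * ?s ^ 2"
      using search_costs(2)[OF inst QP PQ(2), of C] unfolding cS_def .
  qed (use PQ(2) QP in auto)
  have runs_distinct: "runs_within ?M (enc_instance n f)
      (cT * (real (k + 2) * (1 + 2 * real n) ^ k) ^ 4 * ?base ^ n)
      (cS * (real (k + 2) * (1 + 2 * real n) ^ k) ^ 2)"
    if inst: "ksat_instance k n f" and "distinct f" for n f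
  proof (rule runs_within_mono[OF runs[OF inst]])
    let ?s = "1 + real (n + length f)" and ?u = "real (k + 2) * (1 + 2 * real n) ^ k"
    \<comment> \<open>Here k \<ge> 1 lets the summand 1 + n be absorbed as one more copy of the k-th
      power.\<close>
    have "1 + n \<le> (2 * n + 1) ^ 1" by simp
    also have "\<dots> \<le> (2 * n + 1) ^ k" using k by (intro power_increasing) auto
    finally have "1 + (n + length f) \<le> (k + 2) * (2 * n + 1) ^ k"
      using length_distinct_ksat[OF that] by simp
    then have "real (1 + (n + length f)) \<le> real ((k + 2) * (2 * n + 1) ^ k)" by (rule of_nat_mono)
    then have s: "?s \<le> ?u" by (simp add: algebra_simps)
    have "0 \<le> ?base" using y by (simp add: y_def)
    with s show "cT * ?s ^ 4 * ?base ^ n \<le> cT * ?u ^ 4 * ?base ^ n"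
      by (intro mult_right_mono mult_left_mono power_mono) (auto simp: cT_def)
    show "cS * ?s ^ 2 \<le> cS * ?u ^ 2"
      using s by (intro mult_left_mono power_mono) (auto simp: cS_def)
  qed
  show "\<exists>M::program.
        (\<forall>n f. ksat_instance k n f \<longrightarrow>
          success_prob M (enc_instance n f)
            (\<lambda>\<mu>. real (num_sat f (out_assignment n \<mu>)) \<ge> (1 - \<epsilon>) * real (max_sat n f))
          \<ge> 1 - 1 / (real n + 1) ^ a) \<and>
        (\<exists>p q :: real poly. \<forall>n f. ksat_instance k n f \<longrightarrow>
          runs_within M (enc_instance n f)
            (poly p (real (n + length f)) * ?base ^ n) (poly q (real (n + length f)))) \<and>
        (\<exists>p q :: real poly. \<forall>n f. ksat_instance k n f \<and> distinct f \<longrightarrow>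
          runs_within M (enc_instance n f)
            (poly p (real n) * ?base ^ n) (poly q (real n)))"
  proof (rule exI[of _ ?M], intro conjI)
    show "\<exists>p q :: real poly. \<forall>n f. ksat_instance k n f \<longrightarrow>
          runs_within ?M (enc_instance n f)
            (poly p (real (n + length f)) * ?base ^ n) (poly q (real (n + length f)))"
      using runs by (intro exI[of _ "[:cT:] * [:1, 1:] ^ 4"] exI[of _ "[:cS:] * [:1, 1:] ^ 2"]) simp
    show "\<exists>p q :: real poly. \<forall>n f. ksat_instance k n f \<and> distinct f \<longrightarrow>
          runs_within ?M (enc_instance n f) (poly p (real n) * ?base ^ n) (poly q (real n))"
      using runs_distinct
      by (intro exI[of _ "[:cT:] * ([:real (k + 2):] * [:1, 2:] ^ k) ^ 4"]
            exI[of _ "[:cS:] * ([:real (k + 2):] * [:1, 2:] ^ k) ^ 2"]) (simp add: mult.commute)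
  qed (use success in blast)
qed simp

end
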